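(* Let $\underline{s}\in S^{q-1}$, and define for $(\underline{x},\underline{y})\in\mathbb{R}^p\times\mathbb{R}^q$ $$G(\underline{x},\langle \underline{y},\underline{s}\rangle)=\int_{S^{p-1}}e^{\langle \underline{x},\underline{t}\rangle +i\langle \underline{y},\underline{s}\rangle}(\underline{t}+i\underline{s})\,dS(\underline{t}).$$ Then $G$ is a hypermonogenic plane wave and can be written as $$G(\underline{x},\langle \underline{y},\underline{s}\rangle)=\frac{\sqrt{\pi}\,\lambda_{p-1}\,2^{\frac{p-2}{2}}\,\Gamma(\frac{p-1}{2})}{|\underline{x}|^{\frac{p-2}{2}}} \Big(i\,I_{\frac{p-2}{2}}(|\underline{x}|)\,\underline{s}+ \frac{\underline{x}}{|\underline{x}|}\, I_{\frac{p}{2}}(|\underline{x}|)\Big)e^{i\langle \underline{y},\underline{s}\rangle},$$ where $I_\nu$ is the modified Bessel function (of the first kind) and $\lambda_{p-1}$ is the measure of the unit sphere $S^{p-1}$ of $\mathbb{R}^p$.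
   Context: $\mathbb{C}_{p+q}$ is the complex Clifford algebra with generators $e_1,\dots,e_{p+q}$ satisfying $e_ie_j+e_je_i=-2\delta_{ij}$. Vectors $\underline{x},\underline{t}\in\mathbb{R}^p$ are embedded as $\sum_{j=1}^p x_je_j$, $\sum_{j=1}^p t_je_j$, and $\underline{y},\underline{s}\in\mathbb{R}^q$ as $\sum_{j=1}^q y_je_{p+j}$, $\sum_{j=1}^q s_je_{p+j}$. $i$ is the (central) complex imaginary unit, $\langle\cdot,\cdot\rangle$ the Euclidean inner product, $|\cdot|$ the Euclidean norm, $S^{m-1}$ the unit sphere of $\mathbb{R}^m$, $dS$ its scalar surface element, and $\Gamma$ the Gamma function. $\partial_{\underline{x}}=\sum_{j=1}^p e_j\partial_{x_j}$, $\partial_{\underline{y}}=\sum_{j=1}^q e_{p+j}\partial_{y_j}$. A hypermonogenic plane wave is a function of the form $$F(\underline{x},\langle\underline{y},\underline{s}\rangle)=A(|\underline{x}|,\langle\underline{y},\underline{s}\rangle)+B(|\underline{x}|,\langle\underline{y},\underline{s}\rangle)\frac{\underline{x}}{|\underline{x}|}+C(|\underline{x}|,\langle\underline{y},\underline{s}\rangle)\underline{s}+D(|\underline{x}|,\langle\underline{y},\underline{s}\rangle)\frac{\underline{x}}{|\underline{x}|}\underline{s},$$ where $A,B,C,D$ are differentiable complex-valued functions, $\underline{s}\in S^{q-1}$, and $(\partial_{\underline{x}}+\partial_{\underline{y}})F=0$.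
   Formalization: The constant λ_{p-1} is taken as the area of the unit sphere S^{p-2} of R^{p-1}, since with the area of S^{p-1} the formula is false for every p ≥ 2; the closed formula is stated for p ≥ 2 and x ≠ 0, where Γ((p-1)/2) and x/|x| are defined. *)

theory Defs
  imports "HOL-Analysis.Analysis"
begin

section \<open>The complex Clifford algebra\<close>

text \<open>
  An element is given by its coordinates with respect to the basis \<open>e\<^sub>A\<close>, for \<open>A\<close> a set of
  indices, where \<open>e\<^sub>A\<close> is the product of the \<open>e\<^sub>a\<close> (\<open>a \<in> A\<close>) in increasing order of
  \<^const>\<open>to_nat\<close>; any other total order gives an isomorphic algebra. The vector space structure,
  norm and topology are those of the type; the componentwise multiplication of vectors
  is \<^emph>\<open>not\<close> the Clifford product. Scalar multiplication by complex numbers is \<open>*s\<close>.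
\<close>

type_synonym 'n clifford = "(complex, 'n set) vec"

text \<open>
  \<open>e\<^sub>A e\<^sub>B\<close> is \<open>e\<^sub>C\<close> up to sign, with \<open>C\<close> the symmetric difference of \<open>A\<close> and \<open>B\<close>. There is one
  sign change for each pair \<open>a > b\<close> (anticommutation) and one for each pair \<open>a = b\<close> (as
  \<open>e\<^sub>a\<^sup>2 = -1\<close>).
\<close>

definition cl_sign :: "'n::finite set \<Rightarrow> 'n set \<Rightarrow> complex" where
  "cl_sign A B = (\<Prod>a\<in>A. \<Prod>b\<in>B. if to_nat b \<le> to_nat a then - 1 else 1)"

definition cl_mult :: "'n::finite clifford \<Rightarrow> 'n clifford \<Rightarrow> 'n clifford"  (infixl "\<odot>" 70) where
  "u \<odot> v = (\<chi> C. \<Sum>A\<in>UNIV. cl_sign A (sym_diff A C) * u $ A * v $ sym_diff A C)"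

definition cl_one :: "'n::finite clifford" where
  "cl_one = axis {} 1"

definition cl_gen :: "'n::finite \<Rightarrow> 'n clifford" where
  "cl_gen j = axis {j} 1"

lemma sym_diff_cancel: "sym_diff A (sym_diff A B) = B"
  by blast

lemma sym_diff_assoc: "sym_diff (sym_diff A B) C = sym_diff A (sym_diff B C)"
  by blast

lemma prod_sym_diff_sign:
  fixes f :: "'n::finite \<Rightarrow> complex"
  assumes "\<And>a. f a * f a = 1"
  shows "prod f (sym_diff A B) = prod f A * prod f B"
proof -
  have sq: "prod f S * prod f S = 1" for S
    using assms by (simp flip: prod.distrib)
  have "prod f A * prod f B = (prod f (A - B) * prod f (A \<inter> B)) * (prod f (B - A) * prod f (A \<inter> B))"
    by (metis finite_code prod.Int_Diff mult.commute inf_commute)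
  also have "\<dots> = prod f (A - B) * prod f (B - A)"
    using sq[of "A \<inter> B"] by (simp add: algebra_simps)
  also have "\<dots> = prod f (sym_diff A B)"
    by (rule prod.union_disjoint[symmetric]) auto
  finally show ?thesis by simp
qed

lemma cl_sign_sym_diff_left: "cl_sign (sym_diff A B) C = cl_sign A C * cl_sign B C"
  unfolding cl_sign_def
  by (rule prod_sym_diff_sign) (auto simp flip: prod.distrib intro!: prod.neutral)

lemma cl_sign_sym_diff_right: "cl_sign A (sym_diff B C) = cl_sign A B * cl_sign A C"
  unfolding cl_sign_def by (subst prod_sym_diff_sign) (auto simp: prod.distrib)

lemma cl_mult_axis:
  "axis A a \<odot> axis B b = axis (sym_diff A B) (cl_sign A B * a * b)"
proof (rule vec_eq_iff[THEN iffD2], rule allI)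
  fix C
  have "(axis A a \<odot> axis B b) $ C =
      (\<Sum>D\<in>UNIV. if D = A then cl_sign A (sym_diff A C) * a * axis B b $ sym_diff A C else 0)"
    unfolding cl_mult_def vec_lambda_beta by (rule sum.cong) (auto simp: axis_def)
  also have "\<dots> = cl_sign A (sym_diff A C) * a * axis B b $ sym_diff A C"
    by simp
  also have "\<dots> = axis (sym_diff A B) (cl_sign A B * a * b) $ C"
  proof (cases "C = sym_diff A B")
    case True
    then show ?thesis by (simp add: sym_diff_cancel axis_def)
  next
    case False
    then have "sym_diff A C \<noteq> B" by blast
    with False show ?thesis by (simp add: axis_def)
  qed
  finally show "(axis A a \<odot> axis B b) $ C = axis (sym_diff A B) (cl_sign A B * a * b) $ C" .
qed

lemma cl_mult_assoc: "(u \<odot> v) \<odot> w = u \<odot> (v \<odot> w)"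
proof (rule vec_eq_iff[THEN iffD2], rule allI)
  fix D
  have "((u \<odot> v) \<odot> w) $ D = (\<Sum>C\<in>UNIV. \<Sum>A\<in>UNIV. cl_sign C (sym_diff C D) *
      (cl_sign A (sym_diff A C) * u $ A * v $ sym_diff A C) * w $ sym_diff C D)"
    by (simp add: cl_mult_def sum_distrib_left sum_distrib_right)
  also have "\<dots> = (\<Sum>A\<in>UNIV. \<Sum>C\<in>UNIV. cl_sign C (sym_diff C D) *
      (cl_sign A (sym_diff A C) * u $ A * v $ sym_diff A C) * w $ sym_diff C D)"
    by (rule sum.swap)
  also have "\<dots> = (\<Sum>A\<in>UNIV. \<Sum>B\<in>UNIV. cl_sign A (sym_diff A D) * u $ A *
      (cl_sign B (sym_diff B (sym_diff A D)) * v $ B * w $ sym_diff B (sym_diff A D)))"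
  proof (rule sum.cong[OF refl])
    fix A
    show "(\<Sum>C\<in>UNIV. cl_sign C (sym_diff C D) *
        (cl_sign A (sym_diff A C) * u $ A * v $ sym_diff A C) * w $ sym_diff C D) =
      (\<Sum>B\<in>UNIV. cl_sign A (sym_diff A D) * u $ A *
      (cl_sign B (sym_diff B (sym_diff A D)) * v $ B * w $ sym_diff B (sym_diff A D)))"
    proof (rule sum.reindex_bij_witness[where i = "sym_diff A" and j = "sym_diff A"])
      fix C
      define B where "B = sym_diff A C"
      define E where "E = sym_diff C D"
      have *: "C = sym_diff A B" "sym_diff B (sym_diff A D) = E" "sym_diff A D = sym_diff B E"
        unfolding B_def E_def by blast+
      show "cl_sign A (sym_diff A D) * u $ A * (cl_sign (sym_diff A C)
              (sym_diff (sym_diff A C) (sym_diff A D)) * v $ sym_diff A C *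
              w $ sym_diff (sym_diff A C) (sym_diff A D)) =
            cl_sign C (sym_diff C D) * (cl_sign A (sym_diff A C) * u $ A * v $ sym_diff A C) *
              w $ sym_diff C D"
        unfolding B_def[symmetric] E_def[symmetric] *(2)
        unfolding *(1,3) cl_sign_sym_diff_left cl_sign_sym_diff_right
        by (simp add: mult_ac)
    qed (auto simp: sym_diff_cancel)
  qed
  also have "\<dots> = (u \<odot> (v \<odot> w)) $ D"
    by (simp add: cl_mult_def sum_distrib_left)
  finally show "((u \<odot> v) \<odot> w) $ D = (u \<odot> (v \<odot> w)) $ D" .
qed

lemma cl_mult_one [simp]:
  fixes u :: "'n::finite clifford"
  shows "cl_one \<odot> u = u" "u \<odot> cl_one = u"
proof -
  show "cl_one \<odot> u = u"
  proof (rule vec_eq_iff[THEN iffD2], rule allI)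
    fix C :: "'n set"
    have "(cl_one \<odot> u) $ C = (\<Sum>A\<in>(UNIV :: 'n set set). if A = {} then u $ C else 0)"
      unfolding cl_mult_def cl_one_def vec_lambda_beta
      by (rule sum.cong) (auto simp: axis_def cl_sign_def)
    then show "(cl_one \<odot> u) $ C = u $ C" by simp
  qed
  show "u \<odot> cl_one = u"
  proof (rule vec_eq_iff[THEN iffD2], rule allI)
    fix C :: "'n set"
    have "sym_diff A C = {} \<longleftrightarrow> A = C" for A by blast
    then have "(u \<odot> cl_one) $ C = (\<Sum>A\<in>UNIV. if A = C then u $ C else 0)"
      unfolding cl_mult_def cl_one_def vec_lambda_beta
      by (intro sum.cong refl) (simp add: axis_def cl_sign_def)
    then show "(u \<odot> cl_one) $ C = u $ C" by simp
  qed
qed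

lemma cl_mult_add_left: "(u + v) \<odot> w = u \<odot> w + v \<odot> w"
  by (simp add: cl_mult_def vec_eq_iff algebra_simps sum.distrib)

lemma cl_mult_add_right: "u \<odot> (v + w) = u \<odot> v + u \<odot> w"
  by (simp add: cl_mult_def vec_eq_iff algebra_simps sum.distrib)

lemma cl_mult_smult_left: "(c *s u) \<odot> v = c *s (u \<odot> v)"
  by (simp add: cl_mult_def vec_eq_iff sum_distrib_left mult_ac)

lemma cl_mult_smult_right: "u \<odot> (c *s v) = c *s (u \<odot> v)"
  by (simp add: cl_mult_def vec_eq_iff sum_distrib_left mult_ac)

lemma cl_gen_anticommute:
  fixes i j :: "'n::finite"
  shows "cl_gen i \<odot> cl_gen j + cl_gen j \<odot> cl_gen i = (if i = j then - 2 else 0) *s cl_one"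
proof (cases "i = j")
  case False
  then have "to_nat i \<noteq> to_nat j" by simp
  moreover have "sym_diff {j} {i} = sym_diff {i} {j}" by blast
  moreover have "axis A (- 1) = - axis A (1 :: complex)" for A :: "'n set"
    by (simp add: axis_def vec_eq_iff)
  ultimately show ?thesis using False
    unfolding cl_gen_def cl_mult_axis by (auto simp: cl_sign_def)
next
  case True
  have "sym_diff {j} {j} = {}" by blast
  with True show ?thesis
    unfolding cl_gen_def cl_mult_axis
    by (simp add: cl_one_def cl_sign_def vec_eq_iff axis_def)
qed

lemma cl_basis_insert:
  assumes "\<And>a. a \<in> A \<Longrightarrow> to_nat a < to_nat b"
  shows "axis (insert b A) 1 = axis A 1 \<odot> cl_gen b"
proof -
  have "b \<notin> A" using assms by blast
  then have "sym_diff A {b} = insert b A" by blast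
  moreover have "cl_sign A {b} = 1"
    unfolding cl_sign_def using assms by (intro prod.neutral) (auto simp: not_le)
  ultimately show ?thesis by (simp add: cl_gen_def cl_mult_axis)
qed

text \<open>
  The index type of the generators is \<^typ>\<open>'p + 'q\<close>: \<open>Inl j\<close> stands for the index \<open>j\<close> and
  \<open>Inr j\<close> for the index \<open>p + j\<close>.
\<close>

definition vec_x :: "real^'p \<Rightarrow> ('p::finite + 'q::finite) clifford" where
  "vec_x x = (\<Sum>j\<in>UNIV. (x $ j) *\<^sub>R cl_gen (Inl j))"

definition vec_y :: "real^'q \<Rightarrow> ('p::finite + 'q::finite) clifford" where
  "vec_y y = (\<Sum>j\<in>UNIV. (y $ j) *\<^sub>R cl_gen (Inr j))"


section \<open>Hypermonogenic plane waves\<close>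

definition dirac_x ::
  "((real^'p) \<times> (real^'q) \<Rightarrow> ('p::finite + 'q::finite) clifford) \<Rightarrow>
    (real^'p) \<times> (real^'q) \<Rightarrow> ('p + 'q) clifford" where
  "dirac_x F = (\<lambda>(x, y). \<Sum>j\<in>UNIV.
     cl_gen (Inl j) \<odot> vector_derivative (\<lambda>h. F (x + h *\<^sub>R axis j 1, y)) (at 0))"

definition dirac_y ::
  "((real^'p) \<times> (real^'q) \<Rightarrow> ('p::finite + 'q::finite) clifford) \<Rightarrow>
    (real^'p) \<times> (real^'q) \<Rightarrow> ('p + 'q) clifford" where
  "dirac_y F = (\<lambda>(x, y). \<Sum>j\<in>UNIV.
     cl_gen (Inr j) \<odot> vector_derivative (\<lambda>h. F (x, y + h *\<^sub>R axis j 1)) (at 0))"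

text \<open>
  Differentiability of \<open>F\<close> is required so that the partial derivatives in the
  Dirac operators exist. At points with \<open>x = 0\<close> the quotient \<open>x/|x|\<close> is \<open>0\<close> by convention;
  for continuous \<open>F\<close>, \<open>A\<close>, \<open>B\<close>, \<open>C\<close>, \<open>D\<close> this is the value obtained by letting \<open>x \<rightarrow> 0\<close>.
\<close>

definition hypermonogenic_plane_wave_on ::
  "((real^'p) \<times> (real^'q)) set \<Rightarrow> real^'q \<Rightarrow>
    ((real^'p) \<times> (real^'q) \<Rightarrow> ('p::finite + 'q::finite) clifford) \<Rightarrow> bool" where
  "hypermonogenic_plane_wave_on \<Omega> s F \<longleftrightarrow>
     open \<Omega> \<and> s \<in> sphere 0 1 \<and>
     (\<exists>A B C D :: real \<times> real \<Rightarrow> complex.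
        (\<forall>f\<in>{A, B, C, D}. f differentiable_on (\<lambda>(x, y). (norm x, y \<bullet> s)) ` \<Omega>) \<and>
        (\<forall>(x, y)\<in>\<Omega>. F (x, y) =
             A (norm x, y \<bullet> s) *s cl_one
           + B (norm x, y \<bullet> s) *s vec_x (x /\<^sub>R norm x)
           + C (norm x, y \<bullet> s) *s vec_y s
           + D (norm x, y \<bullet> s) *s (vec_x (x /\<^sub>R norm x) \<odot> vec_y s))) \<and>
     F differentiable_on \<Omega> \<and>
     (\<forall>z\<in>\<Omega>. dirac_x F z + dirac_y F z = 0)"


section \<open>Surface measure of the unit sphere\<close>

text \<open>
  Polar coordinates: the surface measure of a set \<open>E\<close> of unit vectors is \<open>n\<close> times the volume of
  the cone \<open>{r t | 0 < r < 1, t \<in> E}\<close> in dimension \<open>n\<close>. In dimension \<open>1\<close> it is the counting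
  measure on \<open>{-1, 1}\<close>.
\<close>

definition sphere_measure :: "'a::euclidean_space measure" where
  "sphere_measure = scale_measure (of_nat DIM('a))
     (distr (restrict_space lborel (ball 0 1 - {0})) (restrict_space borel (sphere 0 1)) sgn)"

text \<open>
  The number \<open>\<lambda>\<^sub>m\<close>: surface area of the unit sphere of the \<open>m\<close>-dimensional Euclidean space (see
  the lemma \<open>measure_sphere_measure\<close> below), so the sphere itself has dimension \<open>m - 1\<close>.
  In the Bessel formula for \<open>plane_wave_G\<close>, \<open>\<lambda>\<close> with index \<open>p - 1\<close> must be the area of the unit
  sphere of the space of dimension \<open>p - 1\<close>. It is the factor in front of the integral of
  \<open>exp (r u) (1 - u\<^sup>2) powr ((p - 3) / 2)\<close> over \<open>-1 < u < 1\<close> when the sphere integral of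
  \<open>exp \<langle>x, t\<rangle>\<close> is reduced to one dimension. With the area of the unit sphere of the
  \<open>p\<close>-dimensional space the formula would be false for every \<open>p \<ge> 2\<close>.
\<close>

definition unit_sphere_area :: "nat \<Rightarrow> real" where
  "unit_sphere_area m = real m * unit_ball_vol (real m)"

lemma space_sphere_measure [simp]: "space (sphere_measure :: 'a::euclidean_space measure) = sphere 0 1"
  by (simp add: sphere_measure_def space_restrict_space space_scale_measure)

lemma sets_sphere_measure [measurable_cong]:
  "sets (sphere_measure :: 'a::euclidean_space measure) = sets (restrict_space borel (sphere 0 1))"
  by (simp add: sphere_measure_def)

lemma sgn_measurable_sphere:
  "sgn \<in> measurable (restrict_space lborel (ball 0 1 - {0 :: 'a::euclidean_space}))
     (restrict_space borel (sphere 0 1))"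
proof (rule measurable_restrict_space2)
  show "sgn \<in> space (restrict_space lborel (ball 0 1 - {0 :: 'a})) \<rightarrow> sphere 0 1"
    by (auto simp: space_restrict_space norm_sgn)
  have "(\<lambda>x::'a. x /\<^sub>R norm x) \<in> borel_measurable borel" by measurable
  then have "(sgn :: 'a \<Rightarrow> 'a) \<in> borel_measurable lborel"
    by (simp add: sgn_div_norm[abs_def])
  then show "(sgn :: 'a \<Rightarrow> 'a) \<in> borel_measurable (restrict_space lborel (ball 0 1 - {0}))"
    by (rule measurable_restrict_space1)
qed

lemma emeasure_sphere_measure:
  fixes E :: "'a::euclidean_space set"
  assumes "E \<in> sets borel" "E \<subseteq> sphere 0 1"
  shows "emeasure sphere_measure E =
    of_nat DIM('a) * emeasure lborel {x \<in> ball 0 1 - {0}. sgn x \<in> E}"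
proof -
  have E: "E \<in> sets (restrict_space borel (sphere 0 1))"
    using assms by (auto simp: sets_restrict_space)
  have "emeasure (distr (restrict_space lborel (ball 0 1 - {0})) (restrict_space borel (sphere 0 1)) sgn) E
      = emeasure (restrict_space lborel (ball 0 1 - {0}))
          (sgn -` E \<inter> space (restrict_space lborel (ball 0 1 - {0})))"
    by (rule emeasure_distr[OF sgn_measurable_sphere E])
  also have "sgn -` E \<inter> space (restrict_space lborel (ball 0 1 - {0})) = {x \<in> ball 0 1 - {0}. sgn x \<in> E}"
    by (auto simp: space_restrict_space)
  also have "emeasure (restrict_space lborel (ball 0 1 - {0})) \<dots> =
      emeasure lborel {x \<in> ball 0 1 - {0}. sgn x \<in> E}"
    by (rule emeasure_restrict_space) auto
  finally show ?thesis by (simp add: sphere_measure_def)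
qed

lemma measure_sphere_measure:
  "measure sphere_measure (sphere 0 1 :: 'a::euclidean_space set) = unit_sphere_area DIM('a)"
proof -
  have eq: "{x \<in> ball 0 1 - {0}. sgn x \<in> sphere 0 1} = ball 0 1 - {0 :: 'a}"
    by (auto simp: norm_sgn)
  have "emeasure sphere_measure (sphere 0 1 :: 'a set) = of_nat DIM('a) * emeasure lborel (ball 0 1 - {0 :: 'a})"
    by (subst emeasure_sphere_measure) (auto simp only: eq closed_sphere borel_closed order_refl)
  also have "emeasure lborel (ball 0 1 - {0 :: 'a}) = emeasure lborel (ball 0 1 :: 'a set)"
    by (rule emeasure_Diff_null_set) auto
  also have "\<dots> = ennreal (unit_ball_vol (real DIM('a)))"
    by (simp add: emeasure_ball)
  finally show ?thesis
    by (simp add: measure_def unit_sphere_area_def enn2real_mult)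
qed


section \<open>The functions of the theorem\<close>

text \<open>Modified Bessel function of the first kind, for positive real argument.\<close>

definition bessel_I :: "real \<Rightarrow> real \<Rightarrow> real" where
  "bessel_I \<nu> r = (\<Sum>k. (r / 2) powr (2 * real k + \<nu>) * rGamma (\<nu> + real k + 1) / fact k)"

definition plane_wave_G ::
  "real^'q \<Rightarrow> (real^'p) \<times> (real^'q) \<Rightarrow> ('p::finite + 'q::finite) clifford" where
  "plane_wave_G s = (\<lambda>(x, y). LINT t|sphere_measure.
     exp (complex_of_real (x \<bullet> t) + \<i> * complex_of_real (y \<bullet> s)) *s (vec_x t + \<i> *s vec_y s))"

end

theory Submission
  imports Defs
begin

text \<open>
  Write \<open>\<sigma>\<close> for the surface measure and \<open>n\<close> for the dimension of the \<open>x\<close>-space. The scalar factor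
  \<open>exp (i \<langle>y, s\<rangle>)\<close> comes out of the integral, so the plane wave is this factor times
  \<open>\<integral> exp \<langle>x, t\<rangle> (t + i s) d\<sigma>(t)\<close> (\<open>plane_wave_G_factor\<close>).

  Monogenicity. Differentiating under the integral sign (\<open>has_derivative_exp_inner_integral\<close>),
  the Dirac operator in \<open>x\<close> multiplies the integrand on the left by \<open>t\<close>, the one in \<open>y\<close> multiplies
  it by \<open>i s\<close>. Their sum puts \<open>(t + i s)\<^sup>2 = - |t|\<^sup>2 + |s|\<^sup>2 + i (t s + s t)\<close> under the integral, and
  this is \<open>0\<close> because \<open>t\<close> and \<open>s\<close> are orthogonal unit vectors (\<open>plane_wave_vector_nilpotent\<close>).

  Plane wave form. As \<open>\<sigma>\<close> is rotation invariant (\<open>integral_sphere_orthogonal\<close>), the integral of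
  \<open>exp \<langle>x, t\<rangle>\<close> is a function \<open>g\<close> of \<open>|x|\<close>. The integral of \<open>exp \<langle>x, t\<rangle> t\<close> is its gradient, hence equals
  \<open>h(|x|) x/|x|\<close> with \<open>h = g'\<close>. So only the components along \<open>s\<close> and along \<open>x/|x|\<close> occur
  (\<open>plane_wave_G_radial_form\<close>), and \<open>g\<close> and \<open>h\<close> are differentiable on the whole real line.

  Bessel functions. Expanding the exponential, the Taylor coefficients of order \<open>m\<close> of \<open>g\<close> and \<open>h\<close> at
  \<open>0\<close> are \<open>c\<^sub>m / m!\<close> and \<open>c\<^sub>m\<^sub>+\<^sub>1 / m!\<close>, where \<open>c\<^sub>m = \<integral> \<langle>e, t\<rangle>\<^sup>m d\<sigma>(t)\<close> is a moment in the direction of a unit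
  vector \<open>e\<close>. The moments of odd order vanish. For those of even order,
  rotation invariance says that for a unit vector \<open>f\<close> orthogonal to \<open>e\<close> the polynomial
  \<open>\<integral> \<langle>e + u f, t\<rangle>\<^sup>2\<^sup>k d\<sigma>(t)\<close> in \<open>u\<close> is \<open>(1 + u\<^sup>2)\<^sup>k c\<^sub>2\<^sub>k\<close>. Comparing the coefficients of \<open>u\<^sup>2\<close> and summing
  over the \<open>f\<close> of an orthonormal basis gives the recurrence
  \<open>(2k + 1) c\<^sub>2\<^sub>k = (n + 2k) c\<^sub>2\<^sub>k\<^sub>+\<^sub>2\<close>, whose solution (\<open>sphere_moment_even\<close>) has the coefficients of the
  Bessel series.
\<close>


section \<open>Rotation invariance of the surface measure\<close>

text \<open>
  By Vitali's covering theorem an open set is, up to a null set, a countable disjoint union of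
  balls. A linear isometry maps each ball to a ball of the same radius and null sets to null
  sets. Only this inequality is shown here; the inverse isometry gives the other one.
\<close>

lemma emeasure_lborel_orthogonal_image_le:
  fixes f :: "'a::euclidean_space \<Rightarrow> 'a"
  assumes f: "orthogonal_transformation f" and U: "open U"
  shows "emeasure lborel (f ` U) \<le> emeasure lborel U"
proof -
  define K where "K = {(a :: 'a, r :: real). 0 < r \<and> ball a r \<subseteq> U}"
  have bij: "bij f" and inj: "inj f" and lin: "linear f"
    using f orthogonal_transformation_bij orthogonal_transformation_inj orthogonal_transformation_linear by blast+
  obtain C where C: "countable C" "C \<subseteq> K"
     "pairwise (\<lambda>i j. disjnt (ball (fst i) (snd i)) (ball (fst j) (snd j))) C"
     "negligible (U - (\<Union>i \<in> C. ball (fst i) (snd i)))"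
  proof (rule Vitali_covering_theorem_balls[of U K fst snd])
    fix x and d :: real assume x: "x \<in> U" "0 < d"
    obtain e where e: "e > 0" "ball x e \<subseteq> U"
      using U x(1) openE by blast
    have "ball x (min e (d/2)) \<subseteq> U" using e by auto
    then show "\<exists>i. i \<in> K \<and> x \<in> ball (fst i) (snd i) \<and> snd i < d"
      using e x by (intro exI[of _ "(x, min e (d/2))"]) (auto simp: K_def)
  qed blast
  define B where "B i = ball (fst i) (snd i)" for i :: "'a \<times> real"
  have fB: "f ` B i = ball (f (fst i)) (snd i)" for i
    using image_orthogonal_transformation_ball[OF f] by (simp add: B_def)
  have Bm: "B i \<in> sets borel" for i by (simp add: B_def)
  have disj: "disjoint_family_on B C"
    using C(3) by (auto simp: disjoint_family_on_def pairwise_def disjnt_def B_def)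
  then have disjf: "disjoint_family_on (\<lambda>i. f ` B i) C"
    by (auto simp: disjoint_family_on_def image_Int[OF inj, symmetric])
  have ball: "emeasure lborel (f ` B i) = emeasure lborel (B i)" if "i \<in> C" for i
  proof -
    have "0 < snd i" using that C(2) by (auto simp: K_def)
    then show ?thesis unfolding fB unfolding B_def by (simp add: emeasure_ball)
  qed
  have N: "negligible (f ` (U - (\<Union>i\<in>C. B i)))"
    using C(4) lin unfolding B_def
    by (intro negligible_differentiable_image_negligible)
       (auto intro: linear_imp_differentiable_on)
  have "f ` U \<subseteq> (\<Union>i\<in>C. f ` B i) \<union> f ` (U - (\<Union>i\<in>C. B i))"
    by blast
  moreover have op: "open (f ` U)"
    using U lin bij by (metis bij_is_surj open_surjective_linear_image)
  have opB: "open (\<Union>i\<in>C. f ` B i)"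
    by (auto simp: fB)
  ultimately have "emeasure lebesgue (f ` U) \<le> emeasure lebesgue ((\<Union>i\<in>C. f ` B i) \<union> f ` (U - (\<Union>i\<in>C. B i)))"
    using N by (intro emeasure_mono) (auto simp: negligible_iff_null_sets intro!: sets.Un)
  also have "\<dots> = emeasure lebesgue (\<Union>i\<in>C. f ` B i)"
    using N opB by (intro emeasure_Un_null_set) (auto simp: negligible_iff_null_sets)
  finally have "emeasure lborel (f ` U) \<le> emeasure lborel (\<Union>i\<in>C. f ` B i)"
    using op opB by simp
  also have "\<dots> = (\<integral>\<^sup>+ i. emeasure lborel (f ` B i) \<partial>count_space C)"
    using C(1) disjf by (intro emeasure_UN_countable) (auto simp: fB)
  also have "\<dots> = (\<integral>\<^sup>+ i. emeasure lborel (B i) \<partial>count_space C)"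
    by (intro nn_integral_cong) (simp add: ball)
  also have "\<dots> = emeasure lborel (\<Union>i\<in>C. B i)"
    using C(1) disj by (intro emeasure_UN_countable[symmetric]) (auto simp: Bm)
  also have "\<dots> \<le> emeasure lborel U"
  proof (intro emeasure_mono)
    show "(\<Union>i\<in>C. B i) \<subseteq> U" using C(2) unfolding K_def B_def by fastforce
  qed (use U in auto)
  finally show ?thesis .
qed

lemma distr_lborel_orthogonal:
  fixes f :: "'a::euclidean_space \<Rightarrow> 'a"
  assumes f: "orthogonal_transformation f"
  shows "distr lborel borel f = lborel"
proof (rule lborel_eqI[symmetric])
  have bij: "bij f" and lin: "linear f"
    using f orthogonal_transformation_bij orthogonal_transformation_linear by blast+
  have [measurable]: "f \<in> borel_measurable borel"
    using lin by (intro borel_measurable_continuous_onI linear_continuous_on linear_linear[THEN iffD1])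
      (simp add: linear_conv_bounded_linear)
  fix l u :: 'a
  assume le: "\<And>b. b \<in> Basis \<Longrightarrow> l \<bullet> b \<le> u \<bullet> b"
  have vim: "f -` box l u = inv f ` box l u"
    using bij by (simp add: bij_vimage_eq_inv_image)
  have "open (f -` box l u)"
    using lin by (intro open_vimage open_box) (simp add: linear_continuous_on linear_conv_bounded_linear)
  then have "emeasure lborel (f ` (f -` box l u)) \<le> emeasure lborel (f -` box l u)"
    by (rule emeasure_lborel_orthogonal_image_le[OF f])
  moreover have "f ` (f -` box l u) = box l u"
    using bij by (simp add: bij_is_surj)
  moreover have "emeasure lborel (inv f ` box l u) \<le> emeasure lborel (box l u)"
    using orthogonal_transformation_inv[OF f] by (intro emeasure_lborel_orthogonal_image_le) auto
  ultimately have "emeasure lborel (f -` box l u) = emeasure lborel (box l u)"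
    by (simp add: vim)
  then show "emeasure (distr lborel borel f) (box l u) = (\<Prod>b\<in>Basis. (u - l) \<bullet> b)"
    using le by (simp add: emeasure_distr emeasure_lborel_box)
qed simp

text \<open>
  A linear isometry commutes with the radial projection \<^const>\<open>sgn\<close>, so the cones that define the
  surface measure are mapped to each other.
\<close>

lemma distr_sphere_measure_orthogonal:
  fixes f :: "'a::euclidean_space \<Rightarrow> 'a"
  assumes f: "orthogonal_transformation f"
  shows "distr sphere_measure sphere_measure f = sphere_measure"
proof (rule measure_eqI)
  have nf [simp]: "norm (f x) = norm x" for x
    using f by (rule orthogonal_transformation_norm)
  have fs: "sgn (f x) = f (sgn x)" for x
    by (simp add: sgn_div_norm orthogonal_transformation_scaleR[OF f])
  have m: "f \<in> borel_measurable borel"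
    using orthogonal_transformation_linear[OF f]
    by (intro borel_measurable_continuous_onI) (simp add: linear_continuous_on linear_conv_bounded_linear)
  then have ms: "f \<in> measurable sphere_measure sphere_measure"
    unfolding measurable_cong_sets[OF sets_sphere_measure sets_sphere_measure]
    by (intro measurable_restrict_space2 measurable_restrict_space1) (auto simp: space_restrict_space)
  fix E assume "E \<in> sets (distr sphere_measure sphere_measure f)"
  then have E: "E \<in> sets borel" "E \<subseteq> sphere 0 1" and Es: "E \<in> sets sphere_measure"
    by (auto simp: sets_sphere_measure sets_restrict_space)
  have f0: "f x = 0 \<longleftrightarrow> x = 0" for x by (metis nf norm_eq_zero)
  have sb: "sgn \<in> borel_measurable (borel :: 'a measure)"
  proof -
    have "(\<lambda>x::'a. x /\<^sub>R norm x) \<in> borel_measurable borel" by measurable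
    then show ?thesis by (simp add: sgn_div_norm[abs_def])
  qed
  have S: "{x \<in> ball 0 1 - {0}. sgn x \<in> E} \<in> sets borel"
  proof -
    have "(ball 0 1 - {0}) \<inter> (sgn -` E \<inter> space borel) \<in> sets borel"
      using measurable_sets[OF sb E(1)] by auto
    then show ?thesis by (simp add: Int_def vimage_def set_diff_eq conj_commute conj_left_commute)
  qed
  have "emeasure (distr sphere_measure sphere_measure f) E = emeasure sphere_measure (f -` E \<inter> sphere 0 1)"
    using ms Es by (simp add: emeasure_distr)
  also have "\<dots> = of_nat DIM('a) * emeasure lborel {x \<in> ball 0 1 - {0}. sgn x \<in> f -` E \<inter> sphere 0 1}"
    using measurable_sets[OF m E(1)] by (intro emeasure_sphere_measure) auto
  also have "{x \<in> ball 0 1 - {0}. sgn x \<in> f -` E \<inter> sphere 0 1} = f -` {x \<in> ball 0 1 - {0}. sgn x \<in> E} \<inter> space lborel"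
    by (auto simp: fs f0 norm_sgn)
  also have "emeasure lborel \<dots> = emeasure (distr lborel borel f) {x \<in> ball 0 1 - {0}. sgn x \<in> E}"
    using S m by (intro emeasure_distr[symmetric]) auto
  also have "of_nat DIM('a) * \<dots> = emeasure sphere_measure E"
    using E by (simp add: distr_lborel_orthogonal[OF f] emeasure_sphere_measure)
  finally show "emeasure (distr sphere_measure sphere_measure f) E = emeasure sphere_measure E" .
qed simp

lemma integral_sphere_orthogonal:
  fixes f :: "'a::euclidean_space \<Rightarrow> 'a" and g :: "'a \<Rightarrow> 'b::{banach, second_countable_topology}"
  assumes f: "orthogonal_transformation f" and g: "continuous_on (sphere 0 1) g"
  shows "(LINT t|sphere_measure. g (f t)) = (LINT t|sphere_measure. g t)"
proof -
  have ms: "f \<in> measurable sphere_measure sphere_measure"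
    unfolding measurable_cong_sets[OF sets_sphere_measure sets_sphere_measure]
    using orthogonal_transformation_linear[OF f]
    by (intro measurable_restrict_space2 measurable_restrict_space1 borel_measurable_continuous_onI)
      (auto simp: space_restrict_space orthogonal_transformation_norm[OF f] linear_continuous_on linear_conv_bounded_linear)
  have mg: "g \<in> borel_measurable sphere_measure"
    unfolding measurable_cong_sets[OF sets_sphere_measure refl]
    by (rule borel_measurable_continuous_on_restrict[OF g])
  show ?thesis
    using integral_distr[OF ms mg] by (simp add: distr_sphere_measure_orthogonal[OF f])
qed

lemma finite_measure_sphere_measure: "finite_measure (sphere_measure :: 'a::euclidean_space measure)"
proof
  have "emeasure sphere_measure (sphere 0 1 :: 'a set) = of_nat DIM('a) * emeasure lborel {x \<in> ball 0 1 - {0}. sgn x \<in> (sphere 0 1 :: 'a set)}"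
    by (rule emeasure_sphere_measure) auto
  also have "\<dots> \<le> of_nat DIM('a) * emeasure lborel (ball 0 1 :: 'a set)"
    by (intro mult_left_mono emeasure_mono) auto
  also have "\<dots> < \<infinity>"
    by (simp add: emeasure_ball ennreal_mult_less_top of_nat_less_top)
  finally show "emeasure sphere_measure (space (sphere_measure :: 'a measure)) \<noteq> \<infinity>"
    by simp
qed

text \<open>
  The sphere is compact and its measure finite. This lemma discharges all integrability
  conditions below, since every integrand is continuous.
\<close>

lemma integrable_sphere_measure:
  fixes g :: "'a::euclidean_space \<Rightarrow> 'b::{banach, second_countable_topology}"
  assumes g: "continuous_on (sphere 0 1) g"
  shows "integrable sphere_measure g"
proof -
  interpret finite_measure "sphere_measure :: 'a measure" by (rule finite_measure_sphere_measure)
  have "bounded (g ` sphere 0 1)"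
    using g by (intro compact_imp_bounded compact_continuous_image) auto
  then obtain B where "\<forall>t\<in>sphere 0 1. norm (g t) \<le> B"
    by (auto simp: bounded_iff)
  moreover have "g \<in> borel_measurable sphere_measure"
    unfolding measurable_cong_sets[OF sets_sphere_measure refl]
    by (rule borel_measurable_continuous_on_restrict[OF g])
  ultimately show ?thesis
    by (intro integrable_const_bound[of _ B]) (auto intro!: AE_I2)
qed


section \<open>Integrals of exponentials over the sphere\<close>

lemma exp_quadratic_remainder:
  fixes b :: real
  shows "\<bar>exp b - 1 - b\<bar> \<le> b\<^sup>2 * exp \<bar>b\<bar>"
proof -
  obtain t where t: "\<bar>t\<bar> \<le> \<bar>b\<bar>" "exp b = (\<Sum>m<2. b ^ m / fact m) + exp t / fact 2 * b ^ 2"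
    using Maclaurin_exp_le[of b 2] by auto
  have "\<bar>exp b - 1 - b\<bar> = exp t / 2 * b\<^sup>2"
    using t(2) by (simp add: eval_nat_numeral)
  also have "\<dots> \<le> exp \<bar>b\<bar> * b\<^sup>2"
  proof (rule mult_right_mono)
    have "exp t \<le> exp \<bar>b\<bar>" using t(1) by simp
    then show "exp t / 2 \<le> exp \<bar>b\<bar>" using exp_gt_zero[of t] by linarith
  qed simp
  finally show ?thesis by (simp add: mult.commute)
qed

text \<open>
  On the unit sphere the quadratic remainder of \<open>exp \<langle>x + h, t\<rangle>\<close> is at most
  \<open>exp (|x| + 1) |h|\<^sup>2\<close> for \<open>|h| < 1\<close>, uniformly in \<open>t\<close>, so the remainder of the integral is quadratic
  in \<open>h\<close> too.
\<close>

lemma has_derivative_exp_inner_integral: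
  fixes f :: "'a::euclidean_space \<Rightarrow> 'b::{banach, second_countable_topology}"
  assumes f: "continuous_on (sphere 0 1) f"
  shows "((\<lambda>x. LINT t|sphere_measure. exp (x \<bullet> t) *\<^sub>R f t) has_derivative
          (\<lambda>h. LINT t|sphere_measure. ((h \<bullet> t) * exp (x \<bullet> t)) *\<^sub>R f t)) (at x)"
proof (rule has_derivativeI_sandwich)
  have cont: "continuous_on (sphere 0 1) (\<lambda>t. ((h \<bullet> t) * exp (x \<bullet> t)) *\<^sub>R f t)" for h x
    using f by (intro continuous_intros)
  have cont': "continuous_on (sphere 0 1) (\<lambda>t. exp (x \<bullet> t) *\<^sub>R f t)" for x
    using f by (intro continuous_intros)
  note int = integrable_sphere_measure[OF cont] integrable_sphere_measure[OF cont']
  have "linear (\<lambda>h. LINT t|sphere_measure. ((h \<bullet> t) * exp (x \<bullet> t)) *\<^sub>R f t)"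
  proof
    fix a b :: 'a and c :: real
    show "(LINT t|sphere_measure. (((a + b) \<bullet> t) * exp (x \<bullet> t)) *\<^sub>R f t) =
      (LINT t|sphere_measure. ((a \<bullet> t) * exp (x \<bullet> t)) *\<^sub>R f t) +
      (LINT t|sphere_measure. ((b \<bullet> t) * exp (x \<bullet> t)) *\<^sub>R f t)"
      by (simp add: inner_add_left distrib_right scaleR_left_distrib int)
    show "(LINT t|sphere_measure. (((c *\<^sub>R a) \<bullet> t) * exp (x \<bullet> t)) *\<^sub>R f t) =
      c *\<^sub>R (LINT t|sphere_measure. ((a \<bullet> t) * exp (x \<bullet> t)) *\<^sub>R f t)"
      by (simp flip: integral_scaleR_right add: mult.assoc)
  qed
  then show "bounded_linear (\<lambda>h. LINT t|sphere_measure. ((h \<bullet> t) * exp (x \<bullet> t)) *\<^sub>R f t)"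
    by (simp add: linear_conv_bounded_linear)
  define K where "K = (LINT t|sphere_measure. exp (norm x + 1) * norm (f t))"
  show "norm ((LINT t|sphere_measure. exp (y \<bullet> t) *\<^sub>R f t) - (LINT t|sphere_measure. exp (x \<bullet> t) *\<^sub>R f t) -
          (LINT t|sphere_measure. ((y - x) \<bullet> t * exp (x \<bullet> t)) *\<^sub>R f t)) / norm (y - x)
        \<le> K * norm (y - x)"
    if y: "y \<noteq> x" "dist y x < 1" for y
  proof -
    define h where "h = y - x"
    have h: "0 < norm h" "norm h < 1" using y by (auto simp: h_def dist_norm)
    have "(LINT t|sphere_measure. exp (y \<bullet> t) *\<^sub>R f t) - (LINT t|sphere_measure. exp (x \<bullet> t) *\<^sub>R f t) -
          (LINT t|sphere_measure. (h \<bullet> t * exp (x \<bullet> t)) *\<^sub>R f t) =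
        (LINT t|sphere_measure. (exp (y \<bullet> t) - exp (x \<bullet> t) - h \<bullet> t * exp (x \<bullet> t)) *\<^sub>R f t)"
      by (simp add: int scaleR_left_diff_distrib)
    also have "norm \<dots> \<le> (LINT t|sphere_measure. exp (norm x + 1) * (norm h)\<^sup>2 * norm (f t))"
    proof (rule Bochner_Integration.integral_norm_bound_integral)
      show "integrable sphere_measure (\<lambda>t. (exp (y \<bullet> t) - exp (x \<bullet> t) - h \<bullet> t * exp (x \<bullet> t)) *\<^sub>R f t)"
        using f by (intro integrable_sphere_measure continuous_intros)
      show "integrable sphere_measure (\<lambda>t. exp (norm x + 1) * (norm h)\<^sup>2 * norm (f t))"
        using f by (intro integrable_sphere_measure continuous_intros)
      fix t :: 'a assume "t \<in> space sphere_measure"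
      then have t: "norm t = 1" by simp
      have b: "\<bar>h \<bullet> t\<bar> \<le> norm h" and xt: "x \<bullet> t \<le> norm x"
        using Cauchy_Schwarz_ineq2[of h t] norm_cauchy_schwarz[of x t] t by auto
      have "exp (y \<bullet> t) - exp (x \<bullet> t) - h \<bullet> t * exp (x \<bullet> t) = exp (x \<bullet> t) * (exp (h \<bullet> t) - 1 - h \<bullet> t)"
        by (simp add: h_def inner_diff_left exp_diff algebra_simps)
      also have "\<bar>\<dots>\<bar> \<le> exp (x \<bullet> t) * ((h \<bullet> t)\<^sup>2 * exp \<bar>h \<bullet> t\<bar>)"
        using exp_quadratic_remainder[of "h \<bullet> t"] by (simp add: abs_mult)
      also have "\<dots> \<le> exp (norm x) * ((norm h)\<^sup>2 * exp 1)"
        using b xt h by (intro mult_mono) (auto simp flip: abs_le_square_iff)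
      finally have "\<bar>exp (y \<bullet> t) - exp (x \<bullet> t) - h \<bullet> t * exp (x \<bullet> t)\<bar> \<le> exp (norm x + 1) * (norm h)\<^sup>2"
        by (simp add: exp_add mult_ac)
      then show "norm ((exp (y \<bullet> t) - exp (x \<bullet> t) - h \<bullet> t * exp (x \<bullet> t)) *\<^sub>R f t)
          \<le> exp (norm x + 1) * (norm h)\<^sup>2 * norm (f t)"
        by (simp add: mult_right_mono)
    qed
    also have "\<dots> = (LINT t|sphere_measure. (norm h)\<^sup>2 * (exp (norm x + 1) * norm (f t)))"
      by (simp only: mult_ac)
    also have "\<dots> = (norm h)\<^sup>2 * K"
      unfolding K_def by (rule integral_mult_right_zero)
    finally show ?thesis
      using h by (simp add: h_def[symmetric] field_simps power2_eq_square)
  qed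
  have "((\<lambda>y. K * norm (y - x)) \<longlongrightarrow> K * norm (x - x)) (at x)"
    by (intro tendsto_intros)
  then show "((\<lambda>y. K * norm (y - x)) \<longlongrightarrow> 0) (at x)"
    by simp
qed simp

text \<open>
  Termwise integration of the exponential series is justified by \<open>|\<langle>e, t\<rangle>| \<le> 1\<close>, which makes
  \<open>|r|\<^sup>m / m!\<close> a summable bound for the terms.
\<close>

lemma exp_inner_integral_sums:
  fixes e :: "'a::euclidean_space" and f :: "'a \<Rightarrow> real"
  assumes e: "norm e = 1" and f: "continuous_on (sphere 0 1) f"
  shows "(\<lambda>m. r ^ m / fact m * (LINT t|sphere_measure. (e \<bullet> t) ^ m * f t)) sums
           (LINT t|sphere_measure. exp (r * (e \<bullet> t)) * f t)"
proof -
  let ?F = "\<lambda>m t. (r * (e \<bullet> t)) ^ m /\<^sub>R fact m * f t"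
  have et: "\<bar>e \<bullet> t\<bar> \<le> 1" if "norm t = 1" for t
    using Cauchy_Schwarz_ineq2[of e t] that e by simp
  have "(\<lambda>m. integral\<^sup>L sphere_measure (?F m)) sums (LINT t|sphere_measure. (\<Sum>m. ?F m t))"
  proof (rule sums_integral)
    show "integrable sphere_measure (?F m)" for m
      using f by (intro integrable_sphere_measure continuous_intros)
    show "AE t in sphere_measure. summable (\<lambda>m. norm (?F m t))"
      unfolding norm_mult by (intro AE_I2 summable_mult2 summable_norm_exp)
    show "summable (\<lambda>m. LINT t|sphere_measure. norm (?F m t))"
    proof (rule summable_comparison_test')
      show "summable (\<lambda>m. \<bar>r\<bar> ^ m /\<^sub>R fact m * (LINT t|sphere_measure. \<bar>f t\<bar>))"
        by (intro summable_mult2 summable_exp_generic)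
      fix m
      have "norm (LINT t|sphere_measure. norm (?F m t)) = (LINT t|sphere_measure. norm (?F m t))"
        by (simp add: integral_nonneg_AE)
      also have "\<dots> \<le> (LINT t|sphere_measure. \<bar>r\<bar> ^ m /\<^sub>R fact m * \<bar>f t\<bar>)"
      proof (rule integral_mono)
        show "integrable sphere_measure (\<lambda>t. norm (?F m t))"
          using f by (intro integrable_sphere_measure continuous_intros)
        show "integrable sphere_measure (\<lambda>t. \<bar>r\<bar> ^ m /\<^sub>R fact m * \<bar>f t\<bar>)"
          using f by (intro integrable_sphere_measure continuous_intros)
        fix t :: 'a assume "t \<in> space sphere_measure"
        then have "\<bar>e \<bullet> t\<bar> ^ m \<le> 1" using et by (simp add: power_le_one)
        then have "\<bar>r\<bar> ^ m * \<bar>e \<bullet> t\<bar> ^ m \<le> \<bar>r\<bar> ^ m"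
          by (simp add: mult_left_le)
        then have "\<bar>r * (e \<bullet> t)\<bar> ^ m \<le> \<bar>r\<bar> ^ m"
          by (simp add: abs_mult power_mult_distrib)
        then show "norm (?F m t) \<le> \<bar>r\<bar> ^ m /\<^sub>R fact m * \<bar>f t\<bar>"
          by (simp add: abs_mult power_abs mult_right_mono mult_left_mono)
      qed
      also have "\<dots> = \<bar>r\<bar> ^ m /\<^sub>R fact m * (LINT t|sphere_measure. \<bar>f t\<bar>)"
        by (rule integral_mult_right_zero)
      finally show "norm (LINT t|sphere_measure. norm (?F m t)) \<le> \<dots>" .
    qed
  qed
  moreover have "(\<Sum>m. ?F m t) = exp (r * (e \<bullet> t)) * f t" for t
    by (simp add: exp_def suminf_mult2[OF summable_exp_generic] del: real_scaleR_def)
  moreover have "integral\<^sup>L sphere_measure (?F m) = r ^ m / fact m * (LINT t|sphere_measure. (e \<bullet> t) ^ m * f t)" for m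
    by (simp add: power_mult_distrib divide_inverse mult_ac flip: integral_mult_right_zero)
  ultimately show ?thesis by simp
qed

lemma integral_sphere_inner_norm_cong:
  fixes x y :: "real^'n" and g :: "real \<Rightarrow> real"
  assumes "norm x = norm y" and g: "continuous_on UNIV g"
  shows "(LINT t|sphere_measure. g (x \<bullet> t)) = (LINT t|sphere_measure. g (y \<bullet> t))"
proof -
  obtain f where f: "orthogonal_transformation f" "f x = y"
    using orthogonal_transformation_exists[OF assms(1)] by metis
  have "(LINT t|sphere_measure. g (y \<bullet> t)) = (LINT t|sphere_measure. g (y \<bullet> f t))"
    by (rule integral_sphere_orthogonal[OF f(1), symmetric])
       (intro continuous_intros continuous_on_compose2[OF g] subset_UNIV)
  also have "(\<lambda>t. g (y \<bullet> f t)) = (\<lambda>t. g (x \<bullet> t))"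
    using f by (simp add: orthogonal_transformation_def fun_eq_iff flip: f(2))
  finally show ?thesis by simp
qed

lemma integral_exp_inner_radial:
  fixes e x :: "real^'n"
  assumes "norm e = 1"
  shows "(LINT t|sphere_measure. exp (x \<bullet> t)) = (LINT t|sphere_measure. exp (norm x * (e \<bullet> t)))"
  using integral_sphere_inner_norm_cong[of x "norm x *\<^sub>R e" exp] assms by (simp add: continuous_intros)

text \<open>
  The left-hand side is the gradient of the integral of \<open>exp \<langle>x, t\<rangle>\<close>, which depends on \<open>|x|\<close> only.
  The chain rule gives the gradient of such a function, away from the origin. At the
  origin \<open>x /\<^sub>R norm x\<close> is \<open>0\<close>, and so is the integral, by the symmetry \<open>t \<mapsto> - t\<close>.
\<close>

lemma integral_exp_inner_vector:
  fixes e x :: "real^'n"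
  assumes e: "norm e = 1"
  shows "(LINT t|sphere_measure. exp (x \<bullet> t) *\<^sub>R t) =
         (LINT t|sphere_measure. exp (norm x * (e \<bullet> t)) * (e \<bullet> t)) *\<^sub>R (x /\<^sub>R norm x)"
proof (cases "x = 0")
  case True
  have "(LINT t|sphere_measure. (t :: real^'n)) = (LINT t|sphere_measure. - t)"
    using integral_sphere_orthogonal[of uminus "\<lambda>t :: real^'n. t"]
    by (simp add: orthogonal_transformation_neg)
  then have "2 *\<^sub>R (LINT t|sphere_measure. (t :: real^'n)) = 0"
    by (simp add: scaleR_2)
  then have "(LINT t|sphere_measure. (t :: real^'n)) = 0" by simp
  with True show ?thesis by simp
next
  case False
  define \<phi> where "\<phi> x = (LINT t|sphere_measure. exp (x \<bullet> t))" for x :: "real^'n"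
  define V where "V = (LINT t|sphere_measure. exp (x \<bullet> t) *\<^sub>R t)"
  define h where "h r = (LINT t|sphere_measure. exp (r * (e \<bullet> t)) * (e \<bullet> t))" for r
  have intV: "integrable sphere_measure (\<lambda>t. exp (x \<bullet> t) *\<^sub>R t)"
    by (intro integrable_sphere_measure continuous_intros)
  have d\<phi>: "(\<phi> has_derivative (\<lambda>v. LINT t|sphere_measure. v \<bullet> t * exp (x \<bullet> t))) (at x)" for x
    using has_derivative_exp_inner_integral[of "\<lambda>_. 1 :: real" x] by (simp add: \<phi>_def[abs_def])
  have "(LINT t|sphere_measure. v \<bullet> t * exp (x \<bullet> t)) = v \<bullet> V" for v
    using intV by (simp add: V_def mult.commute flip: integral_inner_right)
  then have 1: "(\<phi> has_derivative (\<lambda>v. v \<bullet> V)) (at x)"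
    using d\<phi>[of x] by simp
  have "((\<lambda>y. \<phi> (norm y *\<^sub>R e)) has_derivative
      (\<lambda>v. LINT t|sphere_measure. ((v \<bullet> sgn x) *\<^sub>R e) \<bullet> t * exp ((norm x *\<^sub>R e) \<bullet> t))) (at x)"
    by (rule has_derivative_compose[OF _ d\<phi>])
       (use False in \<open>auto intro!: derivative_eq_intros has_derivative_norm[THEN has_derivative_eq_rhs] simp: inner_commute\<close>)
  moreover have "(\<lambda>y. \<phi> (norm y *\<^sub>R e)) = \<phi>"
    by (simp add: fun_eq_iff \<phi>_def integral_exp_inner_radial[OF e])
  moreover have "(LINT t|sphere_measure. ((v \<bullet> sgn x) *\<^sub>R e) \<bullet> t * exp ((norm x *\<^sub>R e) \<bullet> t)) = (v \<bullet> sgn x) * h (norm x)" for v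
    by (simp add: h_def mult_ac flip: integral_mult_right_zero)
  ultimately have 2: "(\<phi> has_derivative (\<lambda>v. v \<bullet> (h (norm x) *\<^sub>R sgn x))) (at x)"
    by (simp add: mult.commute)
  have "v \<bullet> V = v \<bullet> (h (norm x) *\<^sub>R sgn x)" for v
    using has_derivative_unique[OF 1 2] by metis
  then have "V = h (norm x) *\<^sub>R sgn x"
    by (metis vector_eq_rdot inner_commute)
  then show ?thesis by (simp add: V_def h_def sgn_div_norm)
qed


section \<open>Moments of the sphere and Bessel functions\<close>

definition sphere_moment :: "'a::euclidean_space \<Rightarrow> nat \<Rightarrow> real" where
  "sphere_moment x m = (LINT t|sphere_measure. (x \<bullet> t) ^ m)"

lemma sphere_moment_norm_cong:
  fixes x y :: "real^'n"
  assumes "norm x = norm y"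
  shows "sphere_moment x m = sphere_moment y m"
  unfolding sphere_moment_def
  by (rule integral_sphere_inner_norm_cong[OF assms]) (intro continuous_intros)

lemma sphere_moment_eq_norm_power:
  fixes x e :: "real^'n"
  assumes "norm e = 1"
  shows "sphere_moment x m = norm x ^ m * sphere_moment e m"
proof -
  have "sphere_moment x m = sphere_moment (norm x *\<^sub>R e) m"
    using assms by (intro sphere_moment_norm_cong) simp
  also have "\<dots> = norm x ^ m * sphere_moment e m"
    by (simp add: sphere_moment_def power_mult_distrib)
  finally show ?thesis .
qed

lemma sphere_moment_odd:
  fixes x :: "real^'n"
  assumes "odd m"
  shows "sphere_moment x m = 0"
proof -
  have "sphere_moment x m = sphere_moment (- x) m"
    by (rule sphere_moment_norm_cong) simp
  also have "\<dots> = - sphere_moment x m"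
    using assms by (simp add: sphere_moment_def)
  finally show ?thesis by simp
qed

text \<open>
  By rotation invariance the moment of order \<open>2j + 2\<close> in the direction \<open>e + u f\<close>, of norm
  \<open>(1 + u\<^sup>2) powr (1 / 2)\<close>, is the one in the direction \<open>e\<close> times \<open>(1 + u\<^sup>2) ^ (j + 1)\<close>. Both sides are
  polynomials in \<open>u\<close>, and the claim is the equality of their coefficients of \<open>u\<^sup>2\<close>.
\<close>

lemma sphere_mixed_moment:
  fixes e f :: "real^'n"
  assumes e: "norm e = 1" and f: "norm f = 1" and ef: "e \<bullet> f = 0"
  shows "real (2 * j + 1) * (LINT t|sphere_measure. (e \<bullet> t) ^ (2 * j) * (f \<bullet> t)\<^sup>2)
         = sphere_moment e (2 * j + 2)"
proof -
  define N where "N = 2 * j + 2"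
  \<comment> \<open>The coefficients of u ^ i in the two binomial expansions.\<close>
  define c where "c i = of_nat (N choose i) * (LINT t|sphere_measure. (e \<bullet> t) ^ (N - i) * (f \<bullet> t) ^ i)" for i
  define d where "d i = (if even i then of_nat (Suc j choose (i div 2)) * sphere_moment e N else 0)" for i
  have "(\<Sum>i\<le>N. c i * u ^ i) = (\<Sum>i\<le>N. d i * u ^ i)" for u :: real
  proof -
    have "(\<Sum>i\<le>N. c i * u ^ i) =
        (\<Sum>i\<le>N. LINT t|sphere_measure. of_nat (N choose i) * (u * (f \<bullet> t)) ^ i * (e \<bullet> t) ^ (N - i))"
      by (rule sum.cong) (simp_all add: c_def power_mult_distrib mult_ac flip: integral_mult_right_zero)
    also have "\<dots> = (LINT t|sphere_measure. (\<Sum>i\<le>N. of_nat (N choose i) * (u * (f \<bullet> t)) ^ i * (e \<bullet> t) ^ (N - i)))"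
      by (intro Bochner_Integration.integral_sum[symmetric] integrable_sphere_measure continuous_intros)
    also have "\<dots> = sphere_moment (e + u *\<^sub>R f) N"
      by (simp add: sphere_moment_def binomial_ring[symmetric] inner_add_left add.commute)
    also have "\<dots> = norm (e + u *\<^sub>R f) ^ N * sphere_moment e N"
      by (rule sphere_moment_eq_norm_power[OF e])
    also have "norm (e + u *\<^sub>R f) ^ N = ((norm (e + u *\<^sub>R f))\<^sup>2) ^ Suc j"
      unfolding N_def power_mult[symmetric] by (rule arg_cong[where f = "\<lambda>m. _ ^ m"]) simp
    also have "(norm (e + u *\<^sub>R f))\<^sup>2 = u\<^sup>2 + 1"
      using e f ef unfolding power2_norm_eq_inner
      by (simp add: inner_add_left inner_add_right inner_commute norm_eq_1 power2_eq_square)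
    also have "(u\<^sup>2 + 1) ^ Suc j * sphere_moment e N
        = (\<Sum>i\<le>Suc j. of_nat (Suc j choose i) * sphere_moment e N * u ^ (2 * i))"
    proof -
      have "(u\<^sup>2 + 1) ^ J * a = (\<Sum>i\<le>J. of_nat (J choose i) * a * u ^ (2 * i))" for J and a :: real
        unfolding binomial_ring sum_distrib_right power_mult
        by (rule sum.cong) (simp_all only: power_one mult_1_right mult_ac)
      then show ?thesis .
    qed
    also have "\<dots> = (\<Sum>i\<in>{i. i \<le> N \<and> even i}. d i * u ^ i)"
      by (rule sum.reindex_bij_witness[of _ "\<lambda>i. i div 2" "\<lambda>i. 2 * i"]) (auto simp: d_def N_def)
    also have "\<dots> = (\<Sum>i\<le>N. d i * u ^ i)"
      by (rule sum.mono_neutral_left) (auto simp: d_def)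
    finally show ?thesis .
  qed
  then have "c 2 = d 2"
    using polyfun_eq_coeffs[of c N d] by (simp add: N_def)
  moreover have "real (N choose 2) = real (Suc j) * real (2 * j + 1)"
    by (simp add: N_def choose_two algebra_simps)
  ultimately show ?thesis
    by (simp add: c_def d_def N_def)
qed

text \<open>
  Insert the factor \<open>|t|\<^sup>2 = 1\<close> into the moment of order \<open>2j\<close> and expand it in an orthonormal basis that
  contains \<open>e\<close>: the basis vector \<open>e\<close> contributes the moment of order \<open>2j + 2\<close>, each of the \<open>n - 1\<close>
  others contributes that moment divided by \<open>2j + 1\<close>.
\<close>

lemma sphere_moment_recurrence:
  fixes e :: "real^'n"
  assumes e: "norm e = 1"
  shows "real (2 * j + 1) * sphere_moment e (2 * j) = real (CARD('n) + 2 * j) * sphere_moment e (2 * j + 2)"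
proof -
  obtain k :: 'n where True by blast
  define a where "a = (axis k 1 :: real^'n)"
  define I where "I i = (LINT t|sphere_measure. (a \<bullet> t) ^ (2 * j) * (axis i 1 \<bullet> t)\<^sup>2)" for i :: 'n
  have "sphere_moment a (2 * j) = (LINT t|sphere_measure. (\<Sum>i\<in>UNIV. (a \<bullet> t) ^ (2 * j) * ((axis i 1 :: real^'n) \<bullet> t)\<^sup>2))"
    unfolding sphere_moment_def
  proof (rule Bochner_Integration.integral_cong[OF refl])
    fix t :: "real^'n" assume "t \<in> space sphere_measure"
    then have "(\<Sum>i\<in>UNIV. ((axis i 1 :: real^'n) \<bullet> t)\<^sup>2) = 1"
      unfolding inner_axis' by (simp add: norm_eq_1 inner_vec_def power2_eq_square)
    then show "(a \<bullet> t) ^ (2 * j) = (\<Sum>i\<in>UNIV. (a \<bullet> t) ^ (2 * j) * ((axis i 1 :: real^'n) \<bullet> t)\<^sup>2)"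
      by (simp flip: sum_distrib_left)
  qed
  also have "\<dots> = sum I UNIV"
    unfolding I_def by (intro Bochner_Integration.integral_sum integrable_sphere_measure continuous_intros)
  also have "\<dots> = I k + sum I (UNIV - {k})"
    by (simp add: sum.remove)
  finally have "real (2 * j + 1) * sphere_moment a (2 * j) = real (2 * j + 1) * I k + (\<Sum>i\<in>UNIV - {k}. real (2 * j + 1) * I i)"
    by (simp add: distrib_left sum_distrib_left del: of_nat_add of_nat_mult)
  also have "I k = sphere_moment a (2 * j + 2)"
    by (simp add: I_def sphere_moment_def a_def power_add power2_eq_square mult_ac)
  also have "(\<Sum>i\<in>UNIV - {k}. real (2 * j + 1) * I i) = (\<Sum>i\<in>UNIV - {k}. sphere_moment a (2 * j + 2))"
    unfolding I_def a_def
    by (intro sum.cong refl sphere_mixed_moment) (auto simp: inner_axis_axis)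
  also have "\<dots> = (real CARD('n) - 1) * sphere_moment a (2 * j + 2)"
    by (simp add: card_Diff_singleton of_nat_diff Suc_le_eq)
  finally have "real (2 * j + 1) * sphere_moment a (2 * j) = real (CARD('n) + 2 * j) * sphere_moment a (2 * j + 2)"
    by (simp add: algebra_simps)
  moreover have "sphere_moment a m = sphere_moment e m" for m
    by (rule sphere_moment_norm_cong) (simp add: a_def e)
  ultimately show ?thesis by simp
qed

text \<open>
  The classical area formula. With \<^const>\<open>rGamma\<close> instead of a quotient it has the shape of the
  coefficients of the Bessel series.
\<close>

lemma unit_sphere_area_eq_Gamma:
  assumes "m > 0"
  shows "unit_sphere_area m = 2 * pi powr (real m / 2) * rGamma (real m / 2)"
proof -
  have "rGamma (real m / 2) = real m / 2 * rGamma (real m / 2 + 1)"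
    using assms by (simp add: rGamma_plus1)
  then show ?thesis
    by (simp add: unit_sphere_area_def unit_ball_vol_def rGamma_inverse_Gamma field_simps)
qed

text \<open>
  The moment of order \<open>0\<close> is the area of the sphere; then the recurrence applies, with
  \<open>rGamma z = z * rGamma (z + 1)\<close> for \<open>z = n / 2 + k\<close>.
\<close>

lemma sphere_moment_even:
  fixes e :: "real^'n"
  assumes e: "norm e = 1"
  shows "sphere_moment e (2 * k) =
    fact (2 * k) * (2 * pi powr (real CARD('n) / 2) * rGamma (real CARD('n) / 2 + real k)) / (4 ^ k * fact k)"
proof (induction k)
  case 0
  show ?case
    using unit_sphere_area_eq_Gamma[of "CARD('n)"] measure_sphere_measure[where 'a = "real^'n"]
    by (simp add: sphere_moment_def)
next
  case (Suc k)
  define z where "z = real CARD('n) / 2 + real k"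
  have z: "z > 0" by (simp add: z_def add_pos_nonneg)
  have "sphere_moment e (2 * Suc k) = real (2 * k + 1) * sphere_moment e (2 * k) / (2 * z)"
    using sphere_moment_recurrence[OF e, of k] z by (simp add: z_def field_simps)
  also have "\<dots> = real (2 * k + 1) * (fact (2 * k) * (2 * pi powr (real CARD('n) / 2) * (z * rGamma (z + 1))) / (4 ^ k * fact k)) / (2 * z)"
    unfolding Suc.IH z_def[symmetric] by (simp add: rGamma_plus1)
  also have "\<dots> = fact (2 * Suc k) * (2 * pi powr (real CARD('n) / 2) * rGamma (z + 1)) / (4 ^ Suc k * fact (Suc k))"
  proof -
    have "fact (2 * Suc k) = 2 * real (Suc k) * (real (2 * k + 1) * fact (2 * k))"
      by (simp add: algebra_simps)
    moreover have "(fact (Suc k) :: real) = real (Suc k) * fact k" by simp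
    ultimately show ?thesis
      using z by (simp only: power_Suc) (simp add: divide_simps del: fact_Suc of_nat_Suc)
  qed
  finally show ?case
    by (simp add: z_def add_ac)
qed

text \<open>
  As the moments of odd order vanish, the series of this integral has only even powers of \<open>r\<close>, and the
  one of its derivative in the next lemma only odd powers. With the explicit moments, the terms of
  both agree with those of the Bessel series up to the common factor
  \<open>2 * pi powr (n / 2) * (r / 2) powr (1 - n / 2)\<close>.
\<close>

lemma integral_exp_inner_eq_bessel:
  fixes e :: "real^'n"
  assumes e: "norm e = 1" and r: "r > 0"
  shows "(LINT t|sphere_measure. exp (r * (e \<bullet> t))) =
    2 * pi powr (real CARD('n) / 2) * (r / 2) powr (1 - real CARD('n) / 2) * bessel_I (real CARD('n) / 2 - 1) r"
proof -
  define n where "n = real CARD('n)"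
  define c where "c = 2 * pi powr (n / 2) * (r / 2) powr (1 - n / 2)"
  have c0: "c \<noteq> 0" using r by (simp add: c_def)
  have "(\<lambda>m. r ^ m / fact m * sphere_moment e m) sums (LINT t|sphere_measure. exp (r * (e \<bullet> t)))"
    using exp_inner_integral_sums[OF e, of "\<lambda>_. 1" r] by (simp add: sphere_moment_def)
  then have "(\<lambda>k. r ^ (2 * k) / fact (2 * k) * sphere_moment e (2 * k)) sums (LINT t|sphere_measure. exp (r * (e \<bullet> t)))"
    by (subst sums_mono_reindex[of "\<lambda>k. 2 * k" "\<lambda>m. r ^ m / fact m * sphere_moment e m"])
       (auto simp: strict_mono_def image_iff intro!: sphere_moment_odd elim: evenE)
  also have "(\<lambda>k. r ^ (2 * k) / fact (2 * k) * sphere_moment e (2 * k)) =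
    (\<lambda>k. c * ((r / 2) powr (2 * real k + (n / 2 - 1)) * rGamma (n / 2 - 1 + real k + 1) / fact k))"
  proof
    fix k
    have "(r / 2) powr (2 * real k + (n / 2 - 1)) * (r / 2) powr (1 - n / 2) = (r / 2) powr real (2 * k)"
      by (simp flip: powr_add)
    also have "\<dots> = (r / 2) ^ (2 * k)"
      using r by (subst powr_realpow) auto
    also have "\<dots> = r ^ (2 * k) / 4 ^ k"
      by (simp add: power_divide power_mult)
    finally have *: "(r / 2) powr (2 * real k + (n / 2 - 1)) * (r / 2) powr (1 - n / 2) = r ^ (2 * k) / 4 ^ k" .
    have "c * ((r / 2) powr (2 * real k + (n / 2 - 1)) * rGamma (n / 2 - 1 + real k + 1) / fact k)
      = 2 * pi powr (n / 2) * ((r / 2) powr (2 * real k + (n / 2 - 1)) * (r / 2) powr (1 - n / 2)) * rGamma (n / 2 + real k) / fact k"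
      by (simp add: c_def)
    also have "\<dots> = r ^ (2 * k) / fact (2 * k) * sphere_moment e (2 * k)"
      unfolding * unfolding sphere_moment_even[OF e] n_def by simp
    finally show "r ^ (2 * k) / fact (2 * k) * sphere_moment e (2 * k) =
      c * ((r / 2) powr (2 * real k + (n / 2 - 1)) * rGamma (n / 2 - 1 + real k + 1) / fact k)" ..
  qed
  finally have "(\<lambda>k. c * ((r / 2) powr (2 * real k + (n / 2 - 1)) * rGamma (n / 2 - 1 + real k + 1) / fact k))
    sums (LINT t|sphere_measure. exp (r * (e \<bullet> t)))" .
  from sums_divide[OF this, of c]
  have "(LINT t|sphere_measure. exp (r * (e \<bullet> t))) / c = bessel_I (n / 2 - 1) r"
    using c0 by (simp add: bessel_I_def sums_iff)
  then show ?thesis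
    using c0 by (simp add: c_def n_def field_simps)
qed

lemma integral_exp_inner_times_inner_eq_bessel:
  fixes e :: "real^'n"
  assumes e: "norm e = 1" and r: "r > 0"
  shows "(LINT t|sphere_measure. exp (r * (e \<bullet> t)) * (e \<bullet> t)) =
    2 * pi powr (real CARD('n) / 2) * (r / 2) powr (1 - real CARD('n) / 2) * bessel_I (real CARD('n) / 2) r"
proof -
  define n where "n = real CARD('n)"
  define c where "c = 2 * pi powr (n / 2) * (r / 2) powr (1 - n / 2)"
  have c0: "c \<noteq> 0" using r by (simp add: c_def)
  have "(\<lambda>m. r ^ m / fact m * sphere_moment e (Suc m)) sums (LINT t|sphere_measure. exp (r * (e \<bullet> t)) * (e \<bullet> t))"
    using exp_inner_integral_sums[OF e, of "\<lambda>t. e \<bullet> t" r]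
    by (simp add: sphere_moment_def continuous_intros mult.commute)
  moreover have "sphere_moment e (Suc m) = 0" if "m \<notin> range (\<lambda>k. 2 * k + 1)" for m
  proof (rule sphere_moment_odd)
    show "odd (Suc m)" using that by (metis even_Suc oddE rangeI)
  qed
  ultimately have "(\<lambda>k. r ^ (2 * k + 1) / fact (2 * k + 1) * sphere_moment e (Suc (2 * k + 1))) sums (LINT t|sphere_measure. exp (r * (e \<bullet> t)) * (e \<bullet> t))"
    by (subst sums_mono_reindex[of "\<lambda>k. 2 * k + 1" "\<lambda>m. r ^ m / fact m * sphere_moment e (Suc m)"])
       (auto simp: strict_mono_def)
  also have "(\<lambda>k. r ^ (2 * k + 1) / fact (2 * k + 1) * sphere_moment e (Suc (2 * k + 1))) =
    (\<lambda>k. c * ((r / 2) powr (2 * real k + n / 2) * rGamma (n / 2 + real k + 1) / fact k))"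
  proof
    fix k
    have "(r / 2) powr (2 * real k + n / 2) * (r / 2) powr (1 - n / 2) = (r / 2) powr real (2 * k + 1)"
      by (simp add: add_ac flip: powr_add)
    also have "\<dots> = (r / 2) ^ (2 * k + 1)"
      using r by (subst powr_realpow) auto
    also have "\<dots> = r ^ (2 * k + 1) / (2 * 4 ^ k)"
      by (simp add: power_divide power_mult)
    finally have *: "(r / 2) powr (2 * real k + n / 2) * (r / 2) powr (1 - n / 2) = r ^ (2 * k + 1) / (2 * 4 ^ k)" .
    \<comment> \<open>The moment of order 2 k + 2 carries the factor (2 k + 2)!, but the series divides it by (2 k + 1)! only.\<close>
    have fact_ratio: "fact (2 * Suc k) * w / (4 ^ Suc k * fact (Suc k)) = fact (2 * k + 1) * w / (2 * 4 ^ k * fact k)"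
      for w :: real
    proof -
      have cancel: "2 * s * a * w / (4 * q * (s * b)) = a * w / (2 * q * b)" if "s \<noteq> 0" for s a b q :: real
        using that by simp
      have "(fact (2 * Suc k) :: real) = 2 * real (Suc k) * fact (2 * k + 1)"
        by (simp add: algebra_simps)
      moreover have "(fact (Suc k) :: real) = real (Suc k) * fact k" by simp
      ultimately show ?thesis
        by (simp only: power_Suc cancel[of "real (Suc k)"] of_nat_neq_0 not_False_eq_True)
    qed
    have "c * ((r / 2) powr (2 * real k + n / 2) * rGamma (n / 2 + real k + 1) / fact k)
      = 2 * pi powr (n / 2) * ((r / 2) powr (2 * real k + n / 2) * (r / 2) powr (1 - n / 2)) * rGamma (n / 2 + real (Suc k)) / fact k"
      by (simp add: c_def add_ac)
    also have "\<dots> = r ^ (2 * k + 1) / fact (2 * k + 1) * sphere_moment e (2 * Suc k)"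
      unfolding * unfolding sphere_moment_even[OF e] fact_ratio n_def by simp
    finally show "r ^ (2 * k + 1) / fact (2 * k + 1) * sphere_moment e (Suc (2 * k + 1)) =
      c * ((r / 2) powr (2 * real k + n / 2) * rGamma (n / 2 + real k + 1) / fact k)" by simp
  qed
  finally have "(\<lambda>k. c * ((r / 2) powr (2 * real k + n / 2) * rGamma (n / 2 + real k + 1) / fact k))
    sums (LINT t|sphere_measure. exp (r * (e \<bullet> t)) * (e \<bullet> t))" .
  from sums_divide[OF this, of c]
  have "(LINT t|sphere_measure. exp (r * (e \<bullet> t)) * (e \<bullet> t)) / c = bessel_I (n / 2) r"
    using c0 by (simp add: bessel_I_def sums_iff)
  then show ?thesis
    using c0 by (simp add: c_def n_def field_simps)
qed


section \<open>Vectors in the Clifford algebra\<close>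

lemma scaleR_eq_smult: "r *\<^sub>R (v :: (complex, 'm::finite) vec) = complex_of_real r *s v"
  by (simp add: vec_eq_iff scaleR_conv_of_real[where 'a = complex])

lemma bounded_bilinear_smult: "bounded_bilinear (\<lambda>(c :: complex) (v :: (complex, 'm::finite) vec). c *s v)"
  unfolding bilinear_conv_bounded_bilinear[symmetric] bilinear_def
  by (auto intro!: linearI simp: vec_eq_iff algebra_simps)

lemma bounded_bilinear_cl_mult: "bounded_bilinear (\<lambda>u v :: 'n::finite clifford. u \<odot> v)"
  unfolding bilinear_conv_bounded_bilinear[symmetric] bilinear_def
  by (auto intro!: linearI simp: cl_mult_add_left cl_mult_add_right scaleR_eq_smult
      cl_mult_smult_left cl_mult_smult_right)

lemmas bounded_linear_smult = bounded_bilinear.bounded_linear_right[OF bounded_bilinear_smult]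
lemmas bounded_linear_cl_mult_right = bounded_bilinear.bounded_linear_right[OF bounded_bilinear_cl_mult]

lemma bounded_linear_vec_x: "bounded_linear (vec_x :: real^'p \<Rightarrow> ('p::finite + 'q::finite) clifford)"
  unfolding linear_conv_bounded_linear[symmetric] vec_x_def
  by (intro linearI) (simp_all add: scaleR_left_distrib sum.distrib scaleR_sum_right)

text \<open>
  The polarised form of \<open>u\<^sup>2 = - |u|\<^sup>2\<close> for a vector \<open>u\<close> with components along all generators; it
  covers the squares of the vectors \<open>x\<close> and \<open>y\<close> and their anticommutation at once.
\<close>

lemma cl_vector_anticommutator:
  fixes u v :: "'n::finite \<Rightarrow> real"
  defines "W \<equiv> \<lambda>u :: 'n \<Rightarrow> real. \<Sum>j\<in>UNIV. u j *\<^sub>R cl_gen j"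
  shows "W u \<odot> W v + W v \<odot> W u = (- 2 * (\<Sum>j\<in>UNIV. u j * v j)) *\<^sub>R cl_one"
proof -
  have prod: "W a \<odot> W b = (\<Sum>i\<in>UNIV. \<Sum>j\<in>UNIV. (a i * b j) *\<^sub>R (cl_gen i \<odot> cl_gen j))" for a b
    unfolding W_def
    by (simp add: bounded_bilinear.sum_left[OF bounded_bilinear_cl_mult]
        bounded_bilinear.sum_right[OF bounded_bilinear_cl_mult]
        bounded_bilinear.scaleR_left[OF bounded_bilinear_cl_mult]
        bounded_bilinear.scaleR_right[OF bounded_bilinear_cl_mult] scaleR_sum_right)
      (subst sum.swap, simp add: mult.commute)
  have "W v \<odot> W u = (\<Sum>i\<in>UNIV. \<Sum>j\<in>UNIV. (u i * v j) *\<^sub>R (cl_gen j \<odot> cl_gen i))"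
    unfolding prod by (subst sum.swap) (simp add: mult.commute)
  then have "W u \<odot> W v + W v \<odot> W u =
      (\<Sum>i\<in>UNIV. \<Sum>j\<in>UNIV. (u i * v j) *\<^sub>R (cl_gen i \<odot> cl_gen j + cl_gen j \<odot> cl_gen i))"
    unfolding prod[of u v] by (simp add: sum.distrib scaleR_right_distrib)
  also have "\<dots> = (\<Sum>i\<in>UNIV. \<Sum>j\<in>UNIV. if j = i then (- 2 * (u i * v i)) *\<^sub>R cl_one else 0)"
    unfolding cl_gen_anticommute by (intro sum.cong refl) (auto simp: vec_eq_iff scaleR_conv_of_real[where 'a = complex])
  also have "\<dots> = (- 2 * (\<Sum>j\<in>UNIV. u j * v j)) *\<^sub>R cl_one"
    by (simp add: sum_distrib_left scaleR_sum_left)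
  finally show ?thesis .
qed

lemma vec_x_eq_sum: "vec_x x = (\<Sum>j\<in>UNIV. case_sum (\<lambda>i. x $ i) (\<lambda>_ :: 'q::finite. 0) j *\<^sub>R cl_gen (j :: 'p::finite + 'q))"
  by (simp add: vec_x_def UNIV_Plus_UNIV[symmetric] sum.Plus del: UNIV_Plus_UNIV)

lemma vec_y_eq_sum: "vec_y y = (\<Sum>j\<in>UNIV. case_sum (\<lambda>_ :: 'p::finite. 0) (\<lambda>i. y $ i) j *\<^sub>R cl_gen (j :: 'p + 'q::finite))"
  by (simp add: vec_y_def UNIV_Plus_UNIV[symmetric] sum.Plus del: UNIV_Plus_UNIV)

lemma scaleR_eq_of_double: "a + a = (2 * c) *\<^sub>R (b :: 'a::real_vector) \<Longrightarrow> a = c *\<^sub>R b"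
proof -
  assume *: "a + a = (2 * c) *\<^sub>R b"
  have "a = (1 / 2) *\<^sub>R (a + a)" by (simp flip: scaleR_2)
  then show ?thesis unfolding * by simp
qed

lemma vec_x_square: "vec_x x \<odot> vec_x x = (- (x \<bullet> x)) *\<^sub>R (cl_one :: ('p::finite + 'q::finite) clifford)"
proof (rule scaleR_eq_of_double)
  show "vec_x x \<odot> vec_x x + vec_x x \<odot> vec_x x = (2 * - (x \<bullet> x)) *\<^sub>R (cl_one :: ('p + 'q) clifford)"
    using cl_vector_anticommutator[of "case_sum (\<lambda>i. x $ i) (\<lambda>_ :: 'q. 0)" "case_sum (\<lambda>i. x $ i) (\<lambda>_. 0)"]
    unfolding vec_x_eq_sum[symmetric]
    by (simp add: UNIV_Plus_UNIV[symmetric] sum.Plus inner_vec_def del: UNIV_Plus_UNIV)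
qed

lemma vec_y_square: "vec_y y \<odot> vec_y y = (- (y \<bullet> y)) *\<^sub>R (cl_one :: ('p::finite + 'q::finite) clifford)"
proof (rule scaleR_eq_of_double)
  show "vec_y y \<odot> vec_y y + vec_y y \<odot> vec_y y = (2 * - (y \<bullet> y)) *\<^sub>R (cl_one :: ('p + 'q) clifford)"
    using cl_vector_anticommutator[of "case_sum (\<lambda>_ :: 'p. 0) (\<lambda>i. y $ i)" "case_sum (\<lambda>_. 0) (\<lambda>i. y $ i)"]
    unfolding vec_y_eq_sum[symmetric]
    by (simp add: UNIV_Plus_UNIV[symmetric] sum.Plus inner_vec_def del: UNIV_Plus_UNIV)
qed

lemma vec_x_vec_y_anticommute:
  "vec_x x \<odot> vec_y y = - (vec_y y \<odot> (vec_x x :: ('p::finite + 'q::finite) clifford))"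
  using cl_vector_anticommutator[of "case_sum (\<lambda>i. x $ i) (\<lambda>_ :: 'q. 0)" "case_sum (\<lambda>_ :: 'p. 0) (\<lambda>i. y $ i)"]
  unfolding vec_x_eq_sum[symmetric] vec_y_eq_sum[symmetric]
  by (simp add: eq_neg_iff_add_eq_0 UNIV_Plus_UNIV[symmetric] sum.Plus del: UNIV_Plus_UNIV)

lemma plane_wave_vector_nilpotent:
  fixes t :: "real^'p::finite" and s :: "real^'q::finite"
  assumes "norm t = norm s"
  shows "(vec_x t + \<i> *s vec_y s) \<odot> (vec_x t + \<i> *s vec_y s) = (0 :: ('p + 'q) clifford)"
proof -
  have ts: "t \<bullet> t = s \<bullet> s" using assms by (simp flip: power2_norm_eq_inner)
  have "(vec_x t + \<i> *s vec_y s) \<odot> (vec_x t + \<i> *s vec_y s) =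
    vec_x t \<odot> vec_x t + \<i> *s (vec_x t \<odot> vec_y s + vec_y s \<odot> vec_x t) + (\<i> * \<i>) *s (vec_y s \<odot> (vec_y s :: ('p + 'q) clifford))"
    by (simp add: cl_mult_add_left cl_mult_add_right cl_mult_smult_left cl_mult_smult_right
        vector_add_ldistrib vector_smult_assoc algebra_simps)
  also have "\<dots> = 0"
    unfolding vec_x_square vec_y_square vec_x_vec_y_anticommute ts by (simp add: vec_eq_iff)
  finally show ?thesis .
qed


section \<open>The plane wave\<close>

lemma vector_derivative_along:
  assumes "(F has_derivative F') (at z)"
  shows "vector_derivative (\<lambda>h. F (z + h *\<^sub>R v)) (at 0) = F' v"
proof (rule vector_derivative_at)
  have "((\<lambda>h. F (z + h *\<^sub>R v)) has_derivative (\<lambda>h. F' (h *\<^sub>R v))) (at 0)"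
    by (rule has_derivative_compose[of "\<lambda>h. z + h *\<^sub>R v" _ 0 UNIV F])
       (use assms in \<open>auto intro!: derivative_eq_intros\<close>)
  then show "((\<lambda>h. F (z + h *\<^sub>R v)) has_vector_derivative F' v) (at 0)"
    using has_derivative_bounded_linear[OF assms]
    by (simp add: has_vector_derivative_def bounded_linear.linear linear_scale)
qed

lemma has_derivative_complex_exp:
  fixes f :: "'a::real_normed_vector \<Rightarrow> complex"
  assumes "(f has_derivative f') (at x)"
  shows "((\<lambda>x. exp (f x)) has_derivative (\<lambda>h. exp (f x) * f' h)) (at x)"
  using has_derivative_compose[OF assms] DERIV_exp[of "f x"]
  by (auto simp: has_field_derivative_def)

lemma plane_wave_G_factor:
  "plane_wave_G s (x :: real^'p::finite, y :: real^'q::finite) =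
    exp (\<i> * complex_of_real (y \<bullet> s)) *s
      (LINT t|sphere_measure. exp (x \<bullet> t) *\<^sub>R (vec_x t + \<i> *s vec_y s) :: ('p + 'q) clifford)"
proof -
  have *: "exp (complex_of_real (x \<bullet> t) + \<i> * complex_of_real (y \<bullet> s)) *s v =
     exp (\<i> * complex_of_real (y \<bullet> s)) *s (exp (x \<bullet> t) *\<^sub>R v)" for t and v :: "('p + 'q) clifford"
    by (simp add: scaleR_eq_smult vector_smult_assoc exp_add exp_of_real mult.commute)
  have "plane_wave_G s (x, y) = (LINT t|sphere_measure. exp (\<i> * complex_of_real (y \<bullet> s)) *s
      (exp (x \<bullet> t) *\<^sub>R (vec_x t + \<i> *s vec_y s) :: ('p + 'q) clifford))"
    by (simp only: plane_wave_G_def prod.case *)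
  also have "\<dots> = exp (\<i> * complex_of_real (y \<bullet> s)) *s
      (LINT t|sphere_measure. exp (x \<bullet> t) *\<^sub>R (vec_x t + \<i> *s vec_y s))"
    by (intro integral_bounded_linear bounded_linear_smult integrable_sphere_measure continuous_intros
        linear_continuous_on bounded_linear_vec_x)
  finally show ?thesis .
qed

text \<open>
  The partial derivative along \<open>x\<^sub>j\<close> brings a factor \<open>t\<^sub>j\<close> under the integral, the one along \<open>y\<^sub>j\<close> a
  factor \<open>i s\<^sub>j\<close>. After multiplication by the generators and summation these are the Clifford factors
  \<open>t\<close> and \<open>i s\<close> to the left of \<open>t + i s\<close>, and the sum of the two integrands is \<open>exp \<langle>x, t\<rangle> (t + i s)\<^sup>2\<close>.
\<close>

lemma plane_wave_G_dirac:
  fixes s :: "real^'q::finite"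
  defines "G \<equiv> plane_wave_G s :: (real^'p::finite) \<times> (real^'q) \<Rightarrow> ('p + 'q) clifford"
  assumes s: "norm s = 1"
  shows "G differentiable (at z)" "dirac_x G z + dirac_y G z = 0"
proof -
  obtain x y where z: "z = (x, y)" by (cases z)
  define f where "f t = (vec_x t + \<i> *s vec_y s :: ('p + 'q) clifford)" for t :: "real^'p"
  have contf: "continuous_on (sphere 0 1) f"
    unfolding f_def by (intro continuous_intros linear_continuous_on bounded_linear_vec_x)
  define E where "E y = exp (\<i> * complex_of_real (y \<bullet> s))" for y
  define \<Phi> where "\<Phi> x = (LINT t|sphere_measure. exp (x \<bullet> t) *\<^sub>R f t)" for x
  define \<Phi>' where "\<Phi>' h = (LINT t|sphere_measure. (h \<bullet> t * exp (x \<bullet> t)) *\<^sub>R f t)" for h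
  have G: "G = (\<lambda>w. E (snd w) *s \<Phi> (fst w))"
    by (auto simp: G_def plane_wave_G_factor E_def \<Phi>_def f_def)
  have "((\<lambda>w. \<Phi> (fst w)) has_derivative (\<lambda>w. \<Phi>' (fst w))) (at z)"
    unfolding \<Phi>_def \<Phi>'_def
    by (rule has_derivative_compose[of fst fst])
       (auto intro!: derivative_eq_intros has_derivative_exp_inner_integral contf simp: z)
  moreover have "((\<lambda>w. E (snd w)) has_derivative (\<lambda>w. \<i> * complex_of_real (snd w \<bullet> s) * E y)) (at z)"
    unfolding E_def
    by (rule has_derivative_complex_exp[THEN has_derivative_eq_rhs])
       (auto intro!: derivative_eq_intros simp: z mult.commute)
  ultimately have dG: "(G has_derivative (\<lambda>w. E y *s \<Phi>' (fst w) + (\<i> * complex_of_real (snd w \<bullet> s) * E y) *s \<Phi> x)) (at z)"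
    unfolding G using bounded_bilinear.FDERIV[OF bounded_bilinear_smult] by (fastforce simp: z)
  then show "G differentiable (at z)" by (rule differentiableI)
  have int: "integrable sphere_measure (\<lambda>t. exp (x \<bullet> t) *\<^sub>R f t)"
    using contf by (intro integrable_sphere_measure continuous_intros)
  have ints: "integrable sphere_measure (\<lambda>t. exp (x \<bullet> t) *\<^sub>R (v t \<odot> f t))" if "continuous_on (sphere 0 1) v" for v
    using contf that
    by (intro integrable_sphere_measure continuous_intros bounded_bilinear.continuous_on[OF bounded_bilinear_cl_mult])
  note smul = bounded_bilinear.scaleR_left[OF bounded_bilinear_cl_mult]
    bounded_bilinear.scaleR_right[OF bounded_bilinear_cl_mult]
  have "dirac_x G z = (\<Sum>j\<in>UNIV. cl_gen (Inl j) \<odot> (E y *s \<Phi>' (axis j 1)))"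
    using vector_derivative_along[OF dG[unfolded z], of "(axis _ 1, 0)"]
    by (simp add: dirac_x_def z)
  also have "\<dots> = E y *s (\<Sum>j\<in>UNIV. cl_gen (Inl j) \<odot> \<Phi>' (axis j 1))"
    by (simp add: cl_mult_smult_right linear_sum[OF bounded_linear.linear[OF bounded_linear_smult]])
  also have "(\<Sum>j\<in>UNIV. cl_gen (Inl j) \<odot> \<Phi>' (axis j 1)) =
     (\<Sum>j\<in>UNIV. LINT t|sphere_measure. cl_gen (Inl j) \<odot> ((axis j 1 \<bullet> t * exp (x \<bullet> t)) *\<^sub>R f t))"
    unfolding \<Phi>'_def using contf
    by (intro sum.cong refl integral_bounded_linear[symmetric] bounded_linear_cl_mult_right
        integrable_sphere_measure continuous_intros)
  also have "\<dots> = (LINT t|sphere_measure. (\<Sum>j\<in>UNIV. cl_gen (Inl j) \<odot> ((axis j 1 \<bullet> t * exp (x \<bullet> t)) *\<^sub>R f t)))"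
    using contf
    by (intro Bochner_Integration.integral_sum[symmetric] integrable_sphere_measure continuous_intros
        bounded_bilinear.continuous_on[OF bounded_bilinear_cl_mult])
  also have "\<dots> = (LINT t|sphere_measure. exp (x \<bullet> t) *\<^sub>R (vec_x t \<odot> f t))"
    unfolding vec_x_def
    by (simp add: bounded_bilinear.sum_left[OF bounded_bilinear_cl_mult] smul scaleR_sum_right inner_axis' mult.commute)
  finally have dx: "dirac_x G z = E y *s (LINT t|sphere_measure. exp (x \<bullet> t) *\<^sub>R (vec_x t \<odot> f t))" .
  have \<Phi>0: "\<Phi>' 0 = 0" by (simp add: \<Phi>'_def)
  have "dirac_y G z = (\<Sum>j\<in>UNIV. cl_gen (Inr j) \<odot> ((\<i> * complex_of_real (s $ j) * E y) *s \<Phi> x))"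
    using vector_derivative_along[OF dG[unfolded z], of "(0, axis _ 1)"]
    by (simp add: dirac_y_def z \<Phi>0 inner_axis')
  also have "\<dots> = (\<Sum>j\<in>UNIV. E y *s (((s $ j) *\<^sub>R (\<i> *s cl_gen (Inr j))) \<odot> \<Phi> x))"
    by (simp add: scaleR_eq_smult cl_mult_smult_right cl_mult_smult_left vector_smult_assoc mult_ac)
  also have "\<dots> = E y *s ((\<i> *s vec_y s) \<odot> \<Phi> x)"
    unfolding vec_y_def
    by (simp add: bounded_bilinear.sum_left[OF bounded_bilinear_cl_mult] linear_sum[OF bounded_linear.linear[OF bounded_linear_smult]]
       scaleR_eq_smult vector_smult_assoc mult.commute)
  also have "(\<i> *s vec_y s) \<odot> \<Phi> x = (LINT t|sphere_measure. (\<i> *s vec_y s) \<odot> (exp (x \<bullet> t) *\<^sub>R f t))"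
    unfolding \<Phi>_def
    by (intro integral_bounded_linear[symmetric] bounded_linear_cl_mult_right int)
  finally have dy: "dirac_y G z = E y *s (LINT t|sphere_measure. exp (x \<bullet> t) *\<^sub>R ((\<i> *s vec_y s) \<odot> f t))"
    by (simp add: smul)
  have ff: "f t \<odot> f t = vec_x t \<odot> f t + (\<i> *s vec_y s) \<odot> f t" for t
    unfolding f_def by (rule cl_mult_add_left)
  have "dirac_x G z + dirac_y G z = E y *s (LINT t|sphere_measure. exp (x \<bullet> t) *\<^sub>R (f t \<odot> f t))"
    unfolding dx dy vector_add_ldistrib[symmetric] ff scaleR_right_distrib
    by (subst Bochner_Integration.integral_add[symmetric])
       (auto intro!: ints continuous_intros linear_continuous_on bounded_linear_vec_x)
  also have "(LINT t|sphere_measure. exp (x \<bullet> t) *\<^sub>R (f t \<odot> f t)) = (LINT t|(sphere_measure :: (real^'p) measure). 0 :: ('p + 'q) clifford)"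
    by (rule Bochner_Integration.integral_cong) (auto simp: f_def plane_wave_vector_nilpotent s)
  finally show "dirac_x G z + dirac_y G z = 0" by simp
qed

lemma plane_wave_G_radial_form:
  fixes s :: "real^'q::finite" and e x :: "real^'p::finite"
  assumes e: "norm e = 1"
  shows "(plane_wave_G s (x, y) :: ('p + 'q) clifford) =
    exp (\<i> * complex_of_real (y \<bullet> s)) *s
     ((\<i> * complex_of_real (LINT t|sphere_measure. exp (norm x * (e \<bullet> t)))) *s vec_y s
      + complex_of_real (LINT t|sphere_measure. exp (norm x * (e \<bullet> t)) * (e \<bullet> t)) *s vec_x (x /\<^sub>R norm x))"
proof -
  have "(LINT t|sphere_measure. exp (x \<bullet> t) *\<^sub>R (vec_x t + \<i> *s vec_y s)) =
    (LINT t|sphere_measure. vec_x (exp (x \<bullet> t) *\<^sub>R t)) +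
    (LINT t|sphere_measure. exp (x \<bullet> t) *\<^sub>R (\<i> *s (vec_y s :: ('p + 'q) clifford)))"
    unfolding linear_scale[OF bounded_linear.linear[OF bounded_linear_vec_x]] scaleR_right_distrib
    by (intro Bochner_Integration.integral_add integrable_sphere_measure continuous_intros
        linear_continuous_on bounded_linear_vec_x)
  also have "(LINT t|sphere_measure. vec_x (exp (x \<bullet> t) *\<^sub>R t)) =
      (vec_x (LINT t|sphere_measure. exp (x \<bullet> t) *\<^sub>R t) :: ('p + 'q) clifford)"
    by (intro integral_bounded_linear bounded_linear_vec_x integrable_sphere_measure continuous_intros)
  also have "\<dots> = (LINT t|sphere_measure. exp (norm x * (e \<bullet> t)) * (e \<bullet> t)) *\<^sub>R vec_x (x /\<^sub>R norm x)"
    unfolding integral_exp_inner_vector[OF e]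
    by (rule linear_scale[OF bounded_linear.linear[OF bounded_linear_vec_x]])
  also have "(LINT t|sphere_measure. exp (x \<bullet> t) *\<^sub>R (\<i> *s (vec_y s :: ('p + 'q) clifford))) =
      (LINT t|sphere_measure. exp (x \<bullet> t)) *\<^sub>R (\<i> *s vec_y s)"
    by (intro integral_scaleR_left integrable_sphere_measure continuous_intros)
  also have "(LINT t|sphere_measure. exp (x \<bullet> t)) = (LINT t|sphere_measure. exp (norm x * (e \<bullet> t)))"
    by (rule integral_exp_inner_radial[OF e])
  finally show ?thesis
    unfolding plane_wave_G_factor by (simp add: scaleR_eq_smult vector_smult_assoc add.commute mult.commute)
qed

theorem proposition6p3:
  fixes s :: "real^'q::finite"
  assumes "s \<in> sphere 0 1"
  shows "hypermonogenic_plane_wave_on UNIV s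
           (plane_wave_G s :: (real^'p::finite) \<times> (real^'q) \<Rightarrow> ('p + 'q) clifford) \<and>
         (CARD('p) \<ge> 2 \<longrightarrow>
          (\<forall>(x :: real^'p) (y :: real^'q). x \<noteq> 0 \<longrightarrow>
             plane_wave_G s (x, y) =
               complex_of_real (sqrt pi * unit_sphere_area (CARD('p) - 1)
                   * 2 powr ((real CARD('p) - 2) / 2) * Gamma ((real CARD('p) - 1) / 2)
                   / norm x powr ((real CARD('p) - 2) / 2))
               *s (exp (\<i> * complex_of_real (y \<bullet> s))
               *s ((\<i> * complex_of_real (bessel_I ((real CARD('p) - 2) / 2) (norm x))) *s vec_y s
                   + complex_of_real (bessel_I (real CARD('p) / 2) (norm x))
                       *s vec_x (x /\<^sub>R norm x)))))"
proof (intro conjI impI allI)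
  \<comment> \<open>Any unit vector would do: the functions g and h do not depend on it.\<close>
  define e :: "real^'p" where "e = axis undefined 1"
  have e: "norm e = 1" by (simp add: e_def)
  have s: "norm s = 1" using assms by simp
  let ?G = "plane_wave_G s :: (real^'p) \<times> (real^'q) \<Rightarrow> ('p + 'q) clifford"
  define g where "g r = (LINT t|sphere_measure. exp (r * (e \<bullet> t)))" for r
  define h where "h r = (LINT t|sphere_measure. exp (r * (e \<bullet> t)) * (e \<bullet> t))" for r
  note G = plane_wave_G_radial_form[OF e, folded g_def h_def]
  show "hypermonogenic_plane_wave_on UNIV s ?G"
    unfolding hypermonogenic_plane_wave_on_def
  proof (intro conjI exI)
    define B where "B = (\<lambda>(r, u). exp (\<i> * complex_of_real u) * complex_of_real (h r))"
    define C where "C = (\<lambda>(r, u). exp (\<i> * complex_of_real u) * (\<i> * complex_of_real (g r)))"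
    \<comment> \<open>The formulas for g and h make sense for negative r too, so both are differentiable at 0 on both sides.\<close>
    have gd: "g differentiable at r" for r
    proof -
      have "(\<lambda>r. LINT t|sphere_measure. exp ((r *\<^sub>R e) \<bullet> t) *\<^sub>R (1::real)) differentiable at r"
        by (rule differentiable_compose[of _ "\<lambda>r. r *\<^sub>R e"])
           (rule differentiableI[OF has_derivative_exp_inner_integral], auto intro!: derivative_intros)
      then show ?thesis by (simp add: g_def[abs_def])
    qed
    have hd: "h differentiable at r" for r
    proof -
      have "(\<lambda>r. LINT t|sphere_measure. exp ((r *\<^sub>R e) \<bullet> t) *\<^sub>R (e \<bullet> t)) differentiable at r"
        by (rule differentiable_compose[of _ "\<lambda>r. r *\<^sub>R e"])
           (rule differentiableI[OF has_derivative_exp_inner_integral], auto intro!: derivative_intros continuous_intros)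
      then show ?thesis by (simp add: h_def[abs_def])
    qed
    have wave: "(\<lambda>z :: real \<times> real. exp (\<i> * complex_of_real (snd z)) * (c * complex_of_real (k (fst z)))) differentiable at z"
      if k: "\<And>r. k differentiable at r" for k c z
    proof -
      obtain D where D: "(k has_derivative D) (at (fst z))" using k by (auto simp: differentiable_def)
      have "((\<lambda>z. k (fst z)) has_derivative (\<lambda>v. D (fst v))) (at z)"
        by (rule has_derivative_compose[OF has_derivative_fst[OF has_derivative_ident] D])
      then have "(\<lambda>z. complex_of_real (k (fst z))) differentiable at z"
        using differentiableI has_derivative_of_real by blast
      moreover have "(\<lambda>z :: real \<times> real. exp (\<i> * complex_of_real (snd z))) differentiable at z"
        by (rule differentiableI, rule has_derivative_complex_exp) (auto intro!: derivative_eq_intros)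
      ultimately show ?thesis
        by (intro differentiable_mult differentiable_const)
    qed
    show "\<forall>f\<in>{\<lambda>_. 0, B, C, \<lambda>_. 0}. f differentiable_on (\<lambda>(x, y). (norm (x :: real^'p), y \<bullet> s)) ` UNIV"
    proof -
      have "B differentiable at z" for z
        using wave[OF hd, of 1 z] by (simp add: B_def case_prod_unfold)
      moreover have "C differentiable at z" for z
        using wave[OF gd, of \<i> z] by (simp add: C_def case_prod_unfold)
      ultimately show ?thesis
        by (auto simp: differentiable_on_def intro: differentiable_at_withinI)
    qed
    show "\<forall>(x, y)\<in>UNIV. ?G (x, y) =
             (\<lambda>_. 0) (norm x, y \<bullet> s) *s cl_one
           + B (norm x, y \<bullet> s) *s vec_x (x /\<^sub>R norm x)
           + C (norm x, y \<bullet> s) *s vec_y s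
           + (\<lambda>_. 0) (norm x, y \<bullet> s) *s (vec_x (x /\<^sub>R norm x) \<odot> vec_y s)"
      by (auto simp: G B_def C_def vector_add_ldistrib vector_smult_assoc add.commute)
    show "?G differentiable_on UNIV"
      using plane_wave_G_dirac(1)[OF s] by (auto simp: differentiable_on_def)
    show "\<forall>z\<in>UNIV. dirac_x ?G z + dirac_y ?G z = 0"
      using plane_wave_G_dirac(2)[OF s] by blast
  qed (use assms in auto)
  fix x :: "real^'p" and y :: "real^'q"
  assume n: "2 \<le> CARD('p)" and x: "x \<noteq> 0"
  define n where "n = real CARD('p)"
  define K where "K = 2 * pi powr (n / 2) * (norm x / 2) powr (1 - n / 2)"
  have "sqrt pi * unit_sphere_area (CARD('p) - 1) * 2 powr ((n - 2) / 2) * Gamma ((n - 1) / 2) / norm x powr ((n - 2) / 2) = K"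
  proof -
    have n1: "real (CARD('p) - 1) = n - 1" using n by (simp add: n_def of_nat_diff)
    have "(n - 1) / 2 > 0" using n by (simp add: n_def)
    then have "Gamma ((n - 1) / 2) > 0" by (rule Gamma_real_pos)
    then have "Gamma ((n - 1) / 2) * rGamma ((n - 1) / 2) = 1"
      by (simp add: rGamma_inverse_Gamma)
    moreover have "unit_sphere_area (CARD('p) - 1) = 2 * pi powr ((n - 1) / 2) * rGamma ((n - 1) / 2)"
      using n unit_sphere_area_eq_Gamma[of "CARD('p) - 1"] by (simp only: n1)
    ultimately have "unit_sphere_area (CARD('p) - 1) * Gamma ((n - 1) / 2) = 2 * pi powr ((n - 1) / 2)"
      by (simp add: mult_ac)
    \<comment> \<open>The area of the sphere one dimension lower carries pi powr ((n - 1) / 2), and sqrt pi completes the power.\<close>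
    moreover have "sqrt pi * pi powr ((n - 1) / 2) = pi powr (n / 2)"
      by (simp add: powr_half_sqrt[symmetric] powr_add[symmetric] field_simps)
    moreover have "(norm x / 2) powr (1 - n / 2) = 2 powr ((n - 2) / 2) / norm x powr ((n - 2) / 2)"
    proof -
      have exponent: "1 - n / 2 = - ((n - 2) / 2)" by (simp add: field_simps)
      show ?thesis
        unfolding exponent powr_minus by (simp add: powr_divide)
    qed
    ultimately show ?thesis by (simp add: K_def mult_ac)
  qed
  moreover have "g (norm x) = K * bessel_I ((n - 2) / 2) (norm x)"
    using integral_exp_inner_eq_bessel[OF e, of "norm x"] x
    by (simp add: g_def K_def n_def diff_divide_distrib)
  moreover have "h (norm x) = K * bessel_I (n / 2) (norm x)"
    using integral_exp_inner_times_inner_eq_bessel[OF e, of "norm x"] x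
    by (simp add: h_def K_def n_def)
  ultimately show "?G (x, y) =
               complex_of_real (sqrt pi * unit_sphere_area (CARD('p) - 1)
                   * 2 powr ((real CARD('p) - 2) / 2) * Gamma ((real CARD('p) - 1) / 2)
                   / norm x powr ((real CARD('p) - 2) / 2))
               *s (exp (\<i> * complex_of_real (y \<bullet> s))
               *s ((\<i> * complex_of_real (bessel_I ((real CARD('p) - 2) / 2) (norm x))) *s vec_y s
                   + complex_of_real (bessel_I (real CARD('p) / 2) (norm x))
                       *s vec_x (x /\<^sub>R norm x)))"
    unfolding G n_def[symmetric]
    by (simp add: vector_add_ldistrib vector_smult_assoc mult_ac)
qed

end
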